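(* For any integer $d\geq 3$ and any integer $n\ge 2d$, we have $sat_{VC}(n,d-1)\le 4^d$. Moreover, if $d$ is odd or if $d\ge 14$, then $sat_{VC}(n,d-1)\le \frac{1}{2}\binom{2d}{d}$.
   Context: For a family $\mathcal{F}\subseteq 2^{[n]}$ and a set $X$, the projection (trace) is $\mathcal{F}|_X=\{F\cap X: F\in\mathcal{F}\}$; $\mathcal{F}$ shatters $X$ if $\mathcal{F}|_X=2^X$. The VC-dimension $VC(\mathcal{F})$ is the largest size of a set shattered by $\mathcal{F}$. A family $\mathcal{F}\subseteq 2^{[n]}$ is saturated if $VC(\mathcal{F})<VC(\mathcal{F}')$ for every $\mathcal{F}'\subseteq 2^{[n]}$ with $\mathcal{F}'\supsetneq\mathcal{F}$, and it is $d$-saturated if it is saturated and $VC(\mathcal{F})=d$. The saturation number $sat_{VC}(n,d)$ is the minimum size of a $d$-saturated family $\mathcal{F}\subseteq 2^{[n]}$. *)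

theory Defs
  imports Complex_Main
begin

definition trace :: "'a set set \<Rightarrow> 'a set \<Rightarrow> 'a set set" where
  "trace \<F> X = {F \<inter> X | F. F \<in> \<F>}"

definition shatters :: "'a set set \<Rightarrow> 'a set \<Rightarrow> bool" where
  "shatters \<F> X \<longleftrightarrow> trace \<F> X = Pow X"

text \<open>
  Intended for finite families of finite sets. The empty family shatters no set, so its
  VC-dimension is an unspecified natural number. This is harmless below: every nonempty
  family has VC-dimension at least \<open>0\<close> and the family \<open>{{}}\<close> has VC-dimension
  \<open>0\<close>, so the empty family is never saturated, whatever that number is.
\<close>

definition VC :: "'a set set \<Rightarrow> nat" where
  "VC \<F> = Max {card X | X. shatters \<F> X}"

text \<open>The ground set \<open>[n]\<close> is \<open>{1..n}\<close>.\<close>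

definition saturated :: "nat \<Rightarrow> nat set set \<Rightarrow> bool" where
  "saturated n \<F> \<longleftrightarrow>
     \<F> \<subseteq> Pow {1..n} \<and> (\<forall>\<F>'. \<F>' \<subseteq> Pow {1..n} \<and> \<F> \<subset> \<F>' \<longrightarrow> VC \<F> < VC \<F>')"

definition d_saturated :: "nat \<Rightarrow> nat \<Rightarrow> nat set set \<Rightarrow> bool" where
  "d_saturated n d \<F> \<longleftrightarrow> saturated n \<F> \<and> VC \<F> = d"

definition sat_VC :: "nat \<Rightarrow> nat \<Rightarrow> nat" where
  "sat_VC n d = Min {card \<F> | \<F>. d_saturated n d \<F>}"

text \<open>
  The maximum and minimum above are attained: the set of cardinalities in \<open>VC\<close> is finite
  and nonempty for every nonempty family on \<open>{1..n}\<close>, and the one in \<open>sat_VC\<close> is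
  finite, and nonempty whenever \<open>d \<le> n\<close>.
\<close>

lemma shatters_subset: "shatters \<F> X \<Longrightarrow> \<F> \<subseteq> Pow A \<Longrightarrow> X \<subseteq> A"
proof -
  assume "shatters \<F> X" and sub: "\<F> \<subseteq> Pow A"
  then have "X \<in> trace \<F> X" by (simp add: shatters_def)
  then obtain F where "F \<in> \<F>" "X = F \<inter> X" by (auto simp: trace_def)
  then show "X \<subseteq> A" using sub by blast
qed

lemma finite_shattered_cards:
  assumes "\<F> \<subseteq> Pow {1..n::nat}"
  shows "finite {card X | X. shatters \<F> X}"
proof (rule finite_subset)
  show "{card X | X. shatters \<F> X} \<subseteq> card ` Pow {1..n}"
    using shatters_subset[OF _ assms] by blast
qed simp

lemma shattered_cards_nonempty:
  assumes "\<F> \<noteq> {}"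
  shows "{card X | X. shatters \<F> X} \<noteq> {}"
proof -
  have "shatters \<F> {}" using assms by (auto simp: shatters_def trace_def)
  then show ?thesis by blast
qed

lemma shatters_mono:
  assumes "shatters \<F> X" "\<F> \<subseteq> \<G>"
  shows "shatters \<G> X"
proof -
  have "trace \<F> X \<subseteq> trace \<G> X" using assms(2) unfolding trace_def by blast
  moreover have "trace \<G> X \<subseteq> Pow X" unfolding trace_def by blast
  ultimately show ?thesis using assms(1) unfolding shatters_def by simp
qed

lemma VC_mono:
  assumes "\<F> \<noteq> {}" "\<F> \<subseteq> \<G>" "\<G> \<subseteq> Pow {1..n::nat}"
  shows "VC \<F> \<le> VC \<G>"
  unfolding VC_def
proof (rule Max_mono)
  show "{card X | X. shatters \<F> X} \<subseteq> {card X | X. shatters \<G> X}"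
    using shatters_mono[OF _ assms(2)] by blast
qed (rule shattered_cards_nonempty[OF assms(1)], rule finite_shattered_cards[OF assms(3)])

lemma VC_Pow: "VC (Pow {1..d::nat}) = d"
  unfolding VC_def
proof (rule Max_eqI)
  show "finite {card X | X. shatters (Pow {1..d}) X}"
    by (rule finite_shattered_cards[of _ d]) simp
  have "shatters (Pow {1..d}) {1..d}"
    by (auto simp: shatters_def trace_def)
  then show "d \<in> {card X | X. shatters (Pow {1..d}) X}"
    by (auto intro!: exI[of _ "{1..d}"])
next
  fix k assume "k \<in> {card X | X. shatters (Pow {1..d}) X}"
  then obtain X where "k = card X" "X \<subseteq> {1..d}"
    using shatters_subset by blast
  then show "k \<le> d" using card_mono[of "{1..d}" X] by simp
qed

lemma finite_saturated_cards: "finite {card \<F> | \<F>. d_saturated n d \<F>}"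
proof (rule finite_subset)
  show "{card \<F> | \<F>. d_saturated n d \<F>} \<subseteq> card ` Pow (Pow {1..n})"
    by (auto simp: d_saturated_def saturated_def)
qed simp

lemma ex_d_saturated:
  assumes "d \<le> n"
  shows "\<exists>\<F>. d_saturated n d \<F>"
proof -
  let ?S = "{\<F>. \<F> \<subseteq> Pow {1..n} \<and> \<F> \<noteq> {} \<and> VC \<F> = d}"
  have "finite ?S" by (rule finite_subset[of _ "Pow (Pow {1..n})"]) auto
  moreover have "Pow {1..d} \<in> ?S"
  proof -
    have "Pow {1..d} \<subseteq> Pow {1..n}" by (rule Pow_mono) (use assms in simp)
    moreover have "Pow {1..d} \<noteq> {}" by (rule Pow_not_empty)
    ultimately show ?thesis using VC_Pow by simp
  qed
  ultimately have "\<exists>\<F>\<in>?S. \<forall>\<G>\<in>?S. \<F> \<subseteq> \<G> \<longrightarrow> \<F> = \<G>"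
    by (intro finite_has_maximal) auto
  then obtain \<F> where F: "\<F> \<in> ?S" and max: "\<And>\<G>. \<G> \<in> ?S \<Longrightarrow> \<F> \<subseteq> \<G> \<Longrightarrow> \<F> = \<G>"
    by (elim bexE) simp
  have "VC \<F> < VC \<G>" if G: "\<G> \<subseteq> Pow {1..n}" "\<F> \<subset> \<G>" for \<G>
  proof -
    have "VC \<F> \<le> VC \<G>" using VC_mono[of \<F> \<G> n] F G by auto
    moreover have "VC \<G> \<noteq> d" using max[of \<G>] G by auto
    ultimately show ?thesis using F by auto
  qed
  then show ?thesis using F unfolding d_saturated_def saturated_def
    by (intro exI[of _ \<F>]) simp
qed

end

theory Submission
  imports Defs
begin

text \<open>
  Let \<open>G\<close> have \<open>2d\<close> points and let \<open>\<F>\<close> contain exactly one set of each complementary pair of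
  \<open>d\<close>-subsets of \<open>G\<close>; it has half of \<open>2d choose d\<close> members. A \<open>d\<close>-set \<open>X\<close> is disjoint from no
  other \<open>d\<close>-set than \<open>G - X\<close>, so the trace of \<open>\<F>\<close> on \<open>X\<close> misses \<open>X\<close> if \<open>X\<close> is not in \<open>\<F>\<close> and \<open>{}\<close>
  if it is. If all other traces on \<open>d\<close>-sets occur, then every new set realises the missing trace on
  some \<open>d\<close>-set, so \<open>\<F>\<close> is saturated. Replacing points by several copies preserves saturation and
  reduces \<open>n \<ge> 2d\<close> to \<open>2d\<close> points.

  What has to be chosen is thus a selector of one set from each complementary pair that is not constant
  on any slice \<open>{A. Y \<subseteq> A \<and> A \<inter> W = {}}\<close> with \<open>Y, W \<noteq> {}\<close> and \<open>card Y + card W = d\<close>. Arrange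
  the points of \<open>G\<close> in \<open>d\<close> pairs of a left and a right point, and let \<open>ns A\<close> be the number of pairs that
  meet \<open>A\<close> in the left point only. Exchanging a point of \<open>A\<close> for its partner changes the parity of
  \<open>ns A\<close>, and \<open>ns (G - A)\<close> differs from \<open>ns A\<close> by \<open>d\<close> modulo \<open>2\<close>. For odd \<open>d\<close> this parity, flipped on the
  two sets that lie on one side, is a selector as required. For even \<open>d \<ge> 6\<close> one pair is set apart, and
  its four traces determine which of four parity selectors is applied to the remaining \<open>d - 1\<close> pairs.
  For \<open>d = 4\<close> an explicit family of \<open>35\<close> sets on \<open>7\<close> points takes over.
\<close>

subsection \<open>Saturation and duplication of points\<close>

lemma shatters_iff: "shatters \<F> X \<longleftrightarrow> (\<forall>Y\<subseteq>X. \<exists>A\<in>\<F>. A \<inter> X = Y)"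
proof -
  have "trace \<F> X \<subseteq> Pow X" by (auto simp: trace_def)
  then have "shatters \<F> X \<longleftrightarrow> (\<forall>Y\<subseteq>X. Y \<in> trace \<F> X)"
    unfolding shatters_def by blast
  moreover have "Y \<in> trace \<F> X \<longleftrightarrow> (\<exists>A\<in>\<F>. A \<inter> X = Y)" for Y
    unfolding trace_def by blast
  ultimately show ?thesis by simp
qed

lemma shattersD:
  assumes "shatters \<F> X" "Y \<subseteq> X"
  obtains A where "A \<in> \<F>" "A \<inter> X = Y"
  using assms unfolding shatters_iff by blast

lemma shatters_antimono:
  assumes "shatters \<F> X" "X' \<subseteq> X"
  shows "shatters \<F> X'"
  unfolding shatters_iff
proof (intro allI impI)
  fix Y assume Y: "Y \<subseteq> X'"
  then obtain A where "A \<in> \<F>" "A \<inter> X = Y"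
    using assms unfolding shatters_iff by (meson subset_trans)
  then show "\<exists>A\<in>\<F>. A \<inter> X' = Y" using Y assms(2) by blast
qed

text \<open>Both \<open>Y\<close> and \<open>insert x Y\<close> are traces on \<open>X\<close>, of
  two different sets, and only one of these sets can be \<open>A\<close>; without \<open>x\<close>,
  either trace becomes \<open>Y\<close>.\<close>

lemma shatters_insert_remove:
  assumes "shatters (insert A \<F>) X" "x \<in> X"
  shows "shatters \<F> (X - {x})"
  unfolding shatters_iff
proof (intro allI impI)
  fix Y assume Y: "Y \<subseteq> X - {x}"
  have sub: "Y \<subseteq> X" "insert x Y \<subseteq> X" using Y assms(2) by auto
  obtain B where "B \<in> insert A \<F>" "B \<inter> X = Y" by (rule shattersD[OF assms(1) sub(1)])
  moreover obtain C where "C \<in> insert A \<F>" "C \<inter> X = insert x Y"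
    by (rule shattersD[OF assms(1) sub(2)])
  moreover have "insert x Y \<noteq> Y" using Y by auto
  ultimately show "\<exists>A\<in>\<F>. A \<inter> (X - {x}) = Y" using Y by blast
qed

lemma VC_eqI:
  fixes \<F> :: "nat set set"
  assumes "\<F> \<subseteq> Pow {1..n}" "shatters \<F> X" "card X = d - 1" "d \<ge> 1"
    and "\<And>X. shatters \<F> X \<Longrightarrow> card X \<noteq> d"
  shows "VC \<F> = d - 1"
  unfolding VC_def
proof (rule Max_eqI)
  show "finite {card X |X. shatters \<F> X}" by (rule finite_shattered_cards[OF assms(1)])
  show "d - 1 \<in> {card X |X. shatters \<F> X}" using assms(2,3) by (metis (mono_tags, lifting) mem_Collect_eq)
  fix k assume "k \<in> {card X |X. shatters \<F> X}"
  then obtain Z where Z: "shatters \<F> Z" "k = card Z" by blast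
  show "k \<le> d - 1"
  proof (rule ccontr)
    assume "\<not> k \<le> d - 1"
    then have "d \<le> card Z" using Z by simp
    then obtain Z' where "Z' \<subseteq> Z" "card Z' = d" using obtain_subset_with_card_n by metis
    then show False using assms(5) shatters_antimono Z(1) by blast
  qed
qed

lemma VC_ge:
  fixes \<F> :: "nat set set"
  assumes "\<F> \<subseteq> Pow {1..n}" "shatters \<F> X"
  shows "card X \<le> VC \<F>"
  unfolding VC_def using finite_shattered_cards[OF assms(1)] assms(2) by (intro Max_ge) auto

section \<open>Pulling a family back along a map of ground sets\<close>

definition pull :: "(nat \<Rightarrow> 'b) \<Rightarrow> nat \<Rightarrow> 'b set \<Rightarrow> nat set" where
  "pull \<phi> n A = {j\<in>{1..n}. \<phi> j \<in> A}"

lemma pull_subset: "pull \<phi> n A \<subseteq> {1..n}"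
  by (auto simp: pull_def)

lemma image_pull: "\<phi> ` {1..n} = G \<Longrightarrow> A \<subseteq> G \<Longrightarrow> \<phi> ` pull \<phi> n A = A"
  by (fastforce simp: pull_def)

text \<open>A section \<sigma> of \<phi> picks one copy of each point. On the picked copies
  \<open>H\<close> looks like the set of points whose copy lies in \<open>H\<close>, and
  \<open>pull \<phi> n B\<close> looks like \<open>B\<close>, so every trace carries over.\<close>

lemma shatters_section:
  assumes "\<And>b. b \<in> G \<Longrightarrow> \<sigma> b \<in> {1..n} \<and> \<phi> (\<sigma> b) = b"
    and "X \<subseteq> G" and "shatters (insert {b\<in>G. \<sigma> b \<in> H} \<F>) X"
  shows "shatters (insert H (pull \<phi> n ` \<F>)) (\<sigma> ` X)"
  unfolding shatters_iff
proof (intro allI impI)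
  fix Y assume Y: "Y \<subseteq> \<sigma> ` X"
  define Y' where "Y' = {b\<in>X. \<sigma> b \<in> Y}"
  have YY: "Y = \<sigma> ` Y'" using Y by (auto simp: Y'_def)
  have "Y' \<subseteq> X" by (auto simp: Y'_def)
  then obtain B where B: "B \<in> insert {b\<in>G. \<sigma> b \<in> H} \<F>" "B \<inter> X = Y'"
    by (rule shattersD[OF assms(3)])
  have inj: "\<And>a b. a \<in> G \<Longrightarrow> b \<in> G \<Longrightarrow> \<sigma> a = \<sigma> b \<Longrightarrow> a = b" using assms(1) by metis
  show "\<exists>A\<in>insert H (pull \<phi> n ` \<F>). A \<inter> \<sigma> ` X = Y"
  proof (cases "B = {b\<in>G. \<sigma> b \<in> H}")
    case True
    have "H \<inter> \<sigma> ` X = Y" using B(2) True assms(2) YY by auto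
    then show ?thesis by blast
  next
    case False
    then have "B \<in> \<F>" using B by simp
    moreover have "pull \<phi> n B \<inter> \<sigma> ` X = Y"
      unfolding pull_def YY using B(2) assms(1,2) by (auto 0 3)
    ultimately show ?thesis by blast
  qed
qed

text \<open>A set \<open>H\<close> that is not the pullback of a member is read through a section;
  if the set read off is not in the family, \<open>sat\<close> applies to it. The hypothesis
  \<open>sep\<close>, which concerns only points with several copies, guarantees a section of this
  kind.\<close>

lemma pull_saturated:
  fixes G :: "'b set"
  assumes \<phi>: "\<phi> ` {1..n} = G" and sub: "\<F> \<subseteq> Pow G"
    and card_G: "1 \<le> d" "d \<le> card G"
    and not_shattered: "\<And>X. shatters \<F> X \<Longrightarrow> card X \<noteq> d"
    and sat: "\<And>A. A \<subseteq> G \<Longrightarrow> A \<notin> \<F> \<Longrightarrow> \<exists>X\<subseteq>G. card X = d \<and> shatters (insert A \<F>) X"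
    and sep: "\<And>i j A. \<lbrakk>i \<in> {1..n}; j \<in> {1..n}; i \<noteq> j; \<phi> i = \<phi> j; A \<in> \<F>; \<phi> i \<notin> A\<rbrakk>
                \<Longrightarrow> insert (\<phi> i) A \<notin> \<F>"
  shows "d_saturated n (d - 1) (pull \<phi> n ` \<F>)" and "card (pull \<phi> n ` \<F>) = card \<F>"
proof -
  have inj: "inj_on (pull \<phi> n) \<F>"
  proof (rule inj_onI)
    fix A B assume AB: "A \<in> \<F>" "B \<in> \<F>" "pull \<phi> n A = pull \<phi> n B"
    then show "A = B" using image_pull[OF \<phi>] sub by (metis PowD subset_iff)
  qed
  then show "card (pull \<phi> n ` \<F>) = card \<F>" by (rule card_image)
  define \<tau> where "\<tau> b = (SOME j. j \<in> {1..n} \<and> \<phi> j = b)" for b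
  have \<tau>: "\<tau> b \<in> {1..n} \<and> \<phi> (\<tau> b) = b" if "b \<in> G" for b
    unfolding \<tau>_def by (rule someI_ex) (use that \<phi> in blast)
  have pull_sub: "pull \<phi> n ` \<F> \<subseteq> Pow {1..n}" by (auto simp: pull_def)
  have new: "\<exists>X. card X = d \<and> shatters (insert H (pull \<phi> n ` \<F>)) X"
    if H: "H \<subseteq> {1..n}" "H \<notin> pull \<phi> n ` \<F>" for H
  proof -
    have main: ?thesis if s: "\<And>b. b \<in> G \<Longrightarrow> \<sigma> b \<in> {1..n} \<and> \<phi> (\<sigma> b) = b"
      and nF: "{b\<in>G. \<sigma> b \<in> H} \<notin> \<F>" for \<sigma>
    proof -
      obtain X where X: "X \<subseteq> G" "card X = d" "shatters (insert {b\<in>G. \<sigma> b \<in> H} \<F>) X"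
        using sat[OF _ nF] by blast
      have "inj_on \<sigma> X"
        using s X(1) by (intro inj_on_inverseI[where g = \<phi>]) blast
      then have "card (\<sigma> ` X) = d" using X(2) by (simp add: card_image)
      then show ?thesis using shatters_section[OF s X(1,3)] by blast
    qed
    show ?thesis
    proof (cases "{b\<in>G. \<tau> b \<in> H} \<in> \<F>")
      case False
      show ?thesis by (rule main[of \<tau>]) (use \<tau> False in simp_all)
    next
      case True
      define A where "A = {b\<in>G. \<tau> b \<in> H}"
      have AF: "A \<in> \<F>" using True by (simp add: A_def)
      then have "pull \<phi> n A \<noteq> H" using H(2) by auto
      \<comment> \<open>\<open>H\<close> disagrees with the pullback of \<open>A\<close> at some
        copy \<open>v\<close>. Rerouting the section through \<open>v\<close> toggles
        \<open>\<phi> v\<close> in \<open>A\<close>, and by \<open>sep\<close> the result is not in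
        the family.\<close>
      then obtain v where v: "v \<in> {1..n}" "(v \<in> H) \<noteq> (\<phi> v \<in> A)"
        using H(1) unfolding pull_def by blast
      have vG: "\<phi> v \<in> G" using v(1) \<phi> by blast
      have ne: "\<tau> (\<phi> v) \<noteq> v" using v vG by (auto simp: A_def)
      define \<sigma> where "\<sigma> = \<tau>(\<phi> v := v)"
      have s: "\<sigma> b \<in> {1..n} \<and> \<phi> (\<sigma> b) = b" if "b \<in> G" for b
        using \<tau> that v(1) by (auto simp: \<sigma>_def)
      have sep': "\<And>B. B \<in> \<F> \<Longrightarrow> \<phi> v \<notin> B \<Longrightarrow> insert (\<phi> v) B \<notin> \<F>"
        using sep[of v "\<tau> (\<phi> v)"] v(1) \<tau>[OF vG] ne by auto
      have "{b\<in>G. \<sigma> b \<in> H} \<notin> \<F>"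
      proof (cases "v \<in> H")
        case True
        then have "{b\<in>G. \<sigma> b \<in> H} = insert (\<phi> v) A" "\<phi> v \<notin> A"
          using v vG by (auto simp: \<sigma>_def A_def)
        then show ?thesis using sep' AF by metis
      next
        case False
        then have "insert (\<phi> v) {b\<in>G. \<sigma> b \<in> H} = A" "\<phi> v \<notin> {b\<in>G. \<sigma> b \<in> H}"
          using v vG by (auto simp: \<sigma>_def A_def)
        then show ?thesis using sep' AF by metis
      qed
      then show ?thesis by (intro main[of \<sigma>] s)
    qed
  qed
  have not_shattered': "card X \<noteq> d" if X: "shatters (pull \<phi> n ` \<F>) X" for X
  proof -
    have Xn: "X \<subseteq> {1..n}" by (rule shatters_subset[OF X pull_sub])
    \<comment> \<open>Two copies of one point lie in the same pullbacks, so a shattered set cannot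
      contain both.\<close>
    have "inj_on \<phi> X"
    proof (rule inj_onI)
      fix a b assume ab: "a \<in> X" "b \<in> X" "\<phi> a = \<phi> b"
      obtain A where "A \<in> \<F>" "pull \<phi> n A \<inter> X = {a}"
        by (rule shattersD[OF X, of "{a}"]) (use ab(1) in auto)
      then have "a \<in> pull \<phi> n A" "b \<in> pull \<phi> n A \<Longrightarrow> b = a" using ab by auto
      then show "a = b" using ab Xn by (auto simp: pull_def)
    qed
    moreover have "shatters \<F> (\<phi> ` X)"
      unfolding shatters_iff
    proof (intro allI impI)
      fix Y assume Y: "Y \<subseteq> \<phi> ` X"
      obtain A where A: "A \<in> \<F>" "pull \<phi> n A \<inter> X = {a\<in>X. \<phi> a \<in> Y}"
        by (rule shattersD[OF X, of "{a\<in>X. \<phi> a \<in> Y}"]) auto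
      have "a \<in> X \<Longrightarrow> (\<phi> a \<in> A) = (\<phi> a \<in> Y)" for a
        using A(2) Xn by (fastforce simp: pull_def set_eq_iff)
      then have "A \<inter> \<phi> ` X = Y" using Y by auto
      then show "\<exists>A\<in>\<F>. A \<inter> \<phi> ` X = Y" using A(1) by blast
    qed
    ultimately show ?thesis using not_shattered by (metis card_image)
  qed
  have "\<exists>X. shatters (pull \<phi> n ` \<F>) X \<and> card X = d - 1"
  proof -
    \<comment> \<open>Not all subsets of a \<open>d\<close>-set \<open>Z\<close> are members. Adding
      the pullback of a missing one creates a shattered set of size \<open>d\<close>, and dropping a
      point of it leaves a set shattered by the family itself.\<close>
    obtain Z where Z: "Z \<subseteq> G" "card Z = d" using card_G(2) obtain_subset_with_card_n by metis
    have "\<not> shatters \<F> Z" using not_shattered Z(2) by blast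
    then obtain A where "A \<subseteq> Z" "A \<notin> \<F>"
      unfolding shatters_iff by blast
    then have A: "A \<subseteq> G" "A \<notin> \<F>" using Z by auto
    have "pull \<phi> n A \<notin> pull \<phi> n ` \<F>"
    proof
      assume "pull \<phi> n A \<in> pull \<phi> n ` \<F>"
      then obtain B where B: "B \<in> \<F>" "pull \<phi> n A = pull \<phi> n B" by blast
      then have "A = B" using image_pull[OF \<phi>] A(1) sub by (metis PowD subset_iff)
      then show False using A B by simp
    qed
    then obtain X where X: "card X = d" "shatters (insert (pull \<phi> n A) (pull \<phi> n ` \<F>)) X"
      using new[OF pull_subset] by metis
    have "X \<noteq> {}" using X(1) card_G(1) by auto
    then obtain x where x: "x \<in> X" by blast
    then show ?thesis using shatters_insert_remove[OF X(2) x] X(1) by (intro exI[of _ "X - {x}"]) simp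
  qed
  then obtain X where "shatters (pull \<phi> n ` \<F>) X" "card X = d - 1" by (elim exE conjE)
  then have VC: "VC (pull \<phi> n ` \<F>) = d - 1"
    by (rule VC_eqI[OF pull_sub _ _ card_G(1) not_shattered'])
  have "saturated n (pull \<phi> n ` \<F>)"
    unfolding saturated_def
  proof (intro conjI allI impI pull_sub)
    fix \<F>' assume F': "\<F>' \<subseteq> Pow {1..n} \<and> pull \<phi> n ` \<F> \<subset> \<F>'"
    then obtain H where H: "H \<in> \<F>'" "H \<notin> pull \<phi> n ` \<F>" by blast
    moreover have "H \<subseteq> {1..n}" using H(1) F' by blast
    ultimately obtain X where X: "card X = d" "shatters (insert H (pull \<phi> n ` \<F>)) X"
      using new by metis
    have "shatters \<F>' X" by (rule shatters_mono[OF X(2)]) (use H F' in auto)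
    then have "d \<le> VC \<F>'" using VC_ge[of \<F>' n X] X(1) F' by simp
    then show "VC (pull \<phi> n ` \<F>) < VC \<F>'" using VC card_G(1) by simp
  qed
  then show "d_saturated n (d - 1) (pull \<phi> n ` \<F>)" using VC by (simp add: d_saturated_def)
qed

lemma sat_VC_le:
  assumes "d_saturated n k \<F>"
  shows "sat_VC n k \<le> card \<F>"
  unfolding sat_VC_def using assms by (intro Min_le finite_saturated_cards) blast

text \<open>The first \<open>card G\<close> numbers enumerate \<open>G\<close> and all larger ones
  go to \<open>u\<close>, so that only \<open>u\<close> can have several copies.\<close>

lemma obtain_pull_map:
  assumes "finite G" "u \<in> G" "card G \<le> n"
  obtains \<phi> where "\<phi> ` {1..n} = G"
    and "\<And>i j. \<lbrakk>i \<in> {1..n}; j \<in> {1..n}; i \<noteq> j; \<phi> i = \<phi> j\<rbrakk> \<Longrightarrow> \<phi> i = u"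
proof -
  obtain h where h: "bij_betw h {1..card G} G" using ex_bij_betw_nat_finite_1[OF assms(1)] by blast
  define \<phi> where "\<phi> j = (if j \<le> card G then h j else u)" for j
  have "\<phi> ` {1..n} = G"
  proof
    show "\<phi> ` {1..n} \<subseteq> G" using h assms(2) by (auto simp: \<phi>_def bij_betw_def)
    have "\<phi> ` {1..card G} = G" using h by (auto simp: \<phi>_def bij_betw_def)
    then show "G \<subseteq> \<phi> ` {1..n}" using assms(3) by (metis atLeastatMost_subset_iff image_mono le_refl)
  qed
  moreover have "\<phi> i = u" if "i \<in> {1..n}" "j \<in> {1..n}" "i \<noteq> j" "\<phi> i = \<phi> j" for i j
  proof (rule ccontr)
    assume "\<phi> i \<noteq> u"
    then have "i \<le> card G" "j \<le> card G" "h i = h j" using that(4) by (auto simp: \<phi>_def split: if_splits)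
    then have "i = j" using that(1,2) bij_betw_imp_inj_on[OF h] by (simp add: inj_on_eq_iff)
    then show False using that(3) by simp
  qed
  ultimately show thesis by (rule that)
qed

text \<open>By \<open>anti\<close>, complementation turns selected sets into unselected ones and
  exchanges the roles of \<open>Y\<close> and \<open>W\<close>; hence \<open>good\<close> also
  yields unselected sets in every such slice. They are what a new set is compared with.\<close>

lemma sat_VC_le_half_choose:
  fixes G :: "'b set" and f :: "'b set \<Rightarrow> bool"
  assumes fin: "finite G" and card_G: "card G = 2 * d" and d: "d \<ge> 2" and n: "n \<ge> 2 * d"
    and anti: "\<And>A. A \<subseteq> G \<Longrightarrow> card A = d \<Longrightarrow> f (G - A) \<longleftrightarrow> \<not> f A"
    and good: "\<And>Y W. \<lbrakk>Y \<subseteq> G; W \<subseteq> G; Y \<inter> W = {}; Y \<noteq> {}; W \<noteq> {}; card Y + card W = d\<rbrakk>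
                \<Longrightarrow> \<exists>A\<subseteq>G. card A = d \<and> Y \<subseteq> A \<and> A \<inter> W = {} \<and> f A"
  shows "2 * sat_VC n (d - 1) \<le> (2 * d) choose d"
proof -
  define \<F> where "\<F> = {A. A \<subseteq> G \<and> card A = d \<and> f A}"
  have compl: "card (G - A) = d" if "A \<subseteq> G" "card A = d" for A
    using that fin card_G by (simp add: card_Diff_subset finite_subset)
  have not_good: "\<exists>A\<subseteq>G. card A = d \<and> Y \<subseteq> A \<and> A \<inter> W = {} \<and> \<not> f A"
    if YW: "Y \<subseteq> G" "W \<subseteq> G" "Y \<inter> W = {}" "Y \<noteq> {}" "W \<noteq> {}" "card Y + card W = d" for Y W
  proof -
    have "\<exists>A\<subseteq>G. card A = d \<and> W \<subseteq> A \<and> A \<inter> Y = {} \<and> f A"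
      using good[of W Y] YW by (simp add: Int_commute add.commute)
    then obtain A where "A \<subseteq> G" "card A = d" "W \<subseteq> A" "A \<inter> Y = {}" "f A" by blast
    then have "G - A \<subseteq> G" "card (G - A) = d" "Y \<subseteq> G - A" "(G - A) \<inter> W = {}" "\<not> f (G - A)"
      using YW compl anti by auto
    then show ?thesis by blast
  qed
  have not_shattered: "card X \<noteq> d" if X: "shatters \<F> X" for X
  proof
    assume cX: "card X = d"
    have XG: "X \<subseteq> G" by (rule shatters_subset[OF X]) (auto simp: \<F>_def)
    obtain A where A: "A \<in> \<F>" "A \<inter> X = X" by (rule shattersD[OF X order_refl])
    obtain B where B: "B \<in> \<F>" "B \<inter> X = {}" by (rule shattersD[OF X empty_subsetI])
    \<comment> \<open>A \<open>d\<close>-set containing \<open>X\<close> is \<open>X\<close>, and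
      one avoiding \<open>X\<close> is its complement; only one of the two is selected.\<close>
    have "X = A" using A cX fin by (intro card_subset_eq) (auto simp: \<F>_def finite_subset)
    moreover have "B = G - X"
      using B cX compl[OF XG] fin by (intro card_subset_eq) (auto simp: \<F>_def)
    ultimately show False using A B anti by (auto simp: \<F>_def)
  qed
  \<comment> \<open>All traces on \<open>X\<close> except \<open>{}\<close> and \<open>X\<close>
    come from \<open>good\<close> applied to \<open>Y\<close> and \<open>X - Y\<close>; only the two
    extreme ones have to be supplied.\<close>
  have shatters_new: "shatters (insert A \<F>) X"
    if X: "X \<subseteq> G" "card X = d" and Y: "\<exists>B\<in>insert A \<F>. B \<inter> X = {}" "\<exists>B\<in>insert A \<F>. B \<inter> X = X" for A X
    unfolding shatters_iff
  proof (intro allI impI)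
    fix Y assume "Y \<subseteq> X"
    consider "Y = {}" | "Y = X" | "Y \<noteq> {}" "X - Y \<noteq> {}" using \<open>Y \<subseteq> X\<close> by blast
    then show "\<exists>B\<in>insert A \<F>. B \<inter> X = Y"
    proof cases
      case 3
      have "finite X" using X(1) fin finite_subset by blast
      then have "card Y + card (X - Y) = d"
        using \<open>Y \<subseteq> X\<close> X(2) by (metis add_diff_inverse_nat card_Diff_subset card_mono finite_subset not_less)
      then obtain B where "B \<subseteq> G" "card B = d" "Y \<subseteq> B" "B \<inter> (X - Y) = {}" "f B"
        using good[of Y "X - Y"] 3 X(1) \<open>Y \<subseteq> X\<close> by blast
      then show ?thesis using \<open>Y \<subseteq> X\<close> by (intro bexI[of _ B]) (auto simp: \<F>_def)
    qed (use that in blast)+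
  qed
  have sat: "\<exists>X\<subseteq>G. card X = d \<and> shatters (insert A \<F>) X" if A: "A \<subseteq> G" "A \<notin> \<F>" for A
  proof -
    have finA: "finite A" using A(1) fin finite_subset by blast
    \<comment> \<open>The new set lies below or above an unselected \<open>d\<close>-set
      \<open>D\<close>. Below, it supplies the empty trace on \<open>G - D\<close>; above, the full
      trace on \<open>D\<close>. The selected set \<open>G - D\<close> supplies the other extreme
      trace.\<close>
    consider (sub) D where "D \<subseteq> G" "card D = d" "\<not> f D" "A \<subseteq> D"
      | (sup) D where "D \<subseteq> G" "card D = d" "\<not> f D" "D \<subseteq> A"
    proof -
      consider "card A = d" | "card A < d" | "card A > d" by linarith
      then show thesis
      proof cases
        case 1
        then show thesis using A sub[of A] by (auto simp: \<F>_def)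
      next
        case 2
        then have "card A \<le> d - 1" "d - 1 \<le> card G" using card_G by auto
        then obtain Y where Y: "A \<subseteq> Y" "Y \<subseteq> G" "card Y = d - 1"
          using exists_subset_between[OF _ _ A(1) fin] by metis
        have "Y \<noteq> G" using Y(3) card_G d by auto
        then obtain w where w: "w \<in> G" "w \<notin> Y" using Y(2) by blast
        have "\<exists>D\<subseteq>G. card D = d \<and> Y \<subseteq> D \<and> D \<inter> {w} = {} \<and> \<not> f D"
          by (rule not_good) (use Y w d in auto)
        then show thesis using sub Y(1) by blast
      next
        case 3
        have "card (G - A) \<le> d - 1" using 3 A(1) finA card_G by (simp add: card_Diff_subset)
        moreover obtain y where y: "y \<in> A" using 3 by (metis card.empty ex_in_conv not_less_zero)
        moreover have "d - 1 \<le> card (G - {y})" using y A(1) card_G by (simp add: subset_iff)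
        moreover have "G - A \<subseteq> G - {y}" "finite (G - {y})" using y fin by auto
        ultimately obtain W where W: "G - A \<subseteq> W" "W \<subseteq> G - {y}" "card W = d - 1"
          using exists_subset_between[of "G - A" "d - 1" "G - {y}"] by metis
        have "\<exists>D\<subseteq>G. card D = d \<and> {y} \<subseteq> D \<and> D \<inter> W = {} \<and> \<not> f D"
          by (rule not_good) (use W y A d in auto)
        then show thesis using sup W(1) by blast
      qed
    qed
    then show ?thesis
    proof cases
      case sub
      have "f (G - D)" using anti sub by blast
      then have "shatters (insert A \<F>) (G - D)"
        using sub compl[OF sub(1,2)] by (intro shatters_new) (auto simp: \<F>_def)
      then show ?thesis using compl[OF sub(1,2)] by blast
    next
      case sup
      have "f (G - D)" using anti sup by blast
      then have "shatters (insert A \<F>) D"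
        using sup compl[OF sup(1,2)] by (intro shatters_new) (auto simp: \<F>_def)
      then show ?thesis using sup by blast
    qed
  qed
  have "G \<noteq> {}" using card_G d by auto
  then obtain u where u: "u \<in> G" by blast
  obtain \<phi> where \<phi>: "\<phi> ` {1..n} = G"
    using obtain_pull_map[OF fin u] n card_G by metis
  have sep: "insert b A \<notin> \<F>" if "A \<in> \<F>" "b \<notin> A" for A b
    using that fin by (auto simp: \<F>_def finite_subset card_insert_if)
  have sub: "\<F> \<subseteq> Pow G" by (auto simp: \<F>_def)
  have "1 \<le> d" "d \<le> card G" using d card_G by auto
  note pull = pull_saturated[OF \<phi> sub this not_shattered sat sep]
  have "sat_VC n (d - 1) \<le> card \<F>" using sat_VC_le[OF pull(1)] pull(2) by simp
  moreover have "2 * card \<F> = (2 * d) choose d"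
  proof -
    have "bij_betw (\<lambda>A. G - A) \<F> {A. A \<subseteq> G \<and> card A = d \<and> \<not> f A}"
      by (rule bij_betw_byWitness[where f' = "\<lambda>A. G - A"]) (use compl anti in \<open>auto simp: \<F>_def\<close>)
    then have "card \<F> = card {A. A \<subseteq> G \<and> card A = d \<and> \<not> f A}" by (rule bij_betw_same_card)
    moreover have "card {A. A \<subseteq> G \<and> card A = d} = card \<F> + card {A. A \<subseteq> G \<and> card A = d \<and> \<not> f A}"
      using fin unfolding \<F>_def
      by (subst card_Un_disjoint[symmetric]) (auto intro: arg_cong[where f = card])
    ultimately show ?thesis using n_subsets[OF fin, of d] card_G by simp
  qed
  ultimately show ?thesis by linarith
qed

subsection \<open>Points in left-right pairs\<close>

text \<open>Pair \<open>i\<close> consists of the left point \<open>(i, True)\<close> and the right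
  point \<open>(i, False)\<close>; \<open>nl\<close> and \<open>nr\<close> count the left and the
  right points of a set.\<close>

definition board :: "nat \<Rightarrow> (nat \<times> bool) set" where
  "board m = {..<m} \<times> UNIV"

definition nl :: "(nat \<times> bool) set \<Rightarrow> nat" where
  "nl A = card {i. (i, True) \<in> A}"

definition nr :: "(nat \<times> bool) set \<Rightarrow> nat" where
  "nr A = card {i. (i, False) \<in> A}"

definition ns :: "(nat \<times> bool) set \<Rightarrow> nat" where
  "ns A = card {i. (i, True) \<in> A \<and> (i, False) \<notin> A}"

lemma finite_board [simp]: "finite (board m)"
  by (simp add: board_def)

lemma card_board [simp]: "card (board m) = 2 * m"
  by (simp add: board_def card_cartesian_product)

lemma board_iff [simp]: "(i, b) \<in> board m \<longleftrightarrow> i < m"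
  by (simp add: board_def)

lemma finite_fibre: "finite A \<Longrightarrow> finite {i. (i, b) \<in> A}"
  by (rule finite_subset[of _ "fst ` A"]) force+

lemma finite_single: "finite A \<Longrightarrow> finite {i. (i, True) \<in> A \<and> (i, False) \<notin> A}"
  by (rule finite_subset[OF _ finite_fibre[of A True]]) auto

lemma nl_insert [simp]:
  assumes "finite A"
  shows "(i, True) \<notin> A \<Longrightarrow> nl (insert (i, True) A) = Suc (nl A)"
    and "nl (insert (i, False) A) = nl A"
proof -
  assume i: "(i, True) \<notin> A"
  have "{j. (j, True) \<in> insert (i, True) A} = insert i {j. (j, True) \<in> A}" by auto
  then show "nl (insert (i, True) A) = Suc (nl A)"
    using i finite_fibre[OF assms] by (simp add: nl_def)
qed (simp add: nl_def)

lemma nr_insert [simp]: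
  assumes "finite A"
  shows "(i, False) \<notin> A \<Longrightarrow> nr (insert (i, False) A) = Suc (nr A)"
    and "nr (insert (i, True) A) = nr A"
proof -
  assume i: "(i, False) \<notin> A"
  have "{j. (j, False) \<in> insert (i, False) A} = insert i {j. (j, False) \<in> A}" by auto
  then show "nr (insert (i, False) A) = Suc (nr A)"
    using i finite_fibre[OF assms] by (simp add: nr_def)
qed (simp add: nr_def)

text \<open>A left point creates a left-only pair exactly if its partner is absent. Dually, a right
  point destroys one exactly if its partner is present.\<close>

lemma even_ns_insert_left:
  assumes "finite A" "(i, True) \<notin> A"
  shows "even (ns (insert (i, True) A)) \<longleftrightarrow> (even (ns A) \<longleftrightarrow> (i, False) \<in> A)"
proof (cases "(i, False) \<in> A")
  case True
  then have "{j. (j, True) \<in> insert (i, True) A \<and> (j, False) \<notin> insert (i, True) A}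
      = {j. (j, True) \<in> A \<and> (j, False) \<notin> A}" by auto
  then show ?thesis using True by (simp add: ns_def)
next
  case False
  then have "{j. (j, True) \<in> insert (i, True) A \<and> (j, False) \<notin> insert (i, True) A}
      = insert i {j. (j, True) \<in> A \<and> (j, False) \<notin> A}" by auto
  then show ?thesis using False assms finite_single[OF assms(1)] by (simp add: ns_def)
qed

lemma even_ns_insert_right:
  assumes "finite A" "(i, False) \<notin> A"
  shows "even (ns (insert (i, False) A)) \<longleftrightarrow> (even (ns A) \<longleftrightarrow> (i, True) \<notin> A)"
proof (cases "(i, True) \<in> A")
  case True
  then have "{j. (j, True) \<in> A \<and> (j, False) \<notin> A}
      = insert i {j. (j, True) \<in> insert (i, False) A \<and> (j, False) \<notin> insert (i, False) A}"
    using assms by auto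
  then show ?thesis using True finite_single[of "insert (i, False) A"] assms by (simp add: ns_def)
next
  case False
  then have "{j. (j, True) \<in> insert (i, False) A \<and> (j, False) \<notin> insert (i, False) A}
      = {j. (j, True) \<in> A \<and> (j, False) \<notin> A}" by auto
  then show ?thesis using False by (simp add: ns_def)
qed

lemmas even_ns_insert = even_ns_insert_left even_ns_insert_right

lemma nl_eq_0: "finite A \<Longrightarrow> nl A = 0 \<longleftrightarrow> (\<forall>i. (i, True) \<notin> A)"
  using finite_fibre[of A True] by (simp add: nl_def)

lemma nr_eq_0: "finite A \<Longrightarrow> nr A = 0 \<longleftrightarrow> (\<forall>i. (i, False) \<notin> A)"
  using finite_fibre[of A False] by (simp add: nr_def)

lemma ns_no_left: "finite A \<Longrightarrow> nl A = 0 \<Longrightarrow> ns A = 0"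
  by (simp add: nl_eq_0 ns_def)

lemma ns_no_right: "finite A \<Longrightarrow> nr A = 0 \<Longrightarrow> ns A = nl A"
  by (simp add: nr_eq_0 ns_def nl_def)

lemma card_nl_nr:
  assumes "finite A"
  shows "card A = nl A + nr A"
proof -
  have "A = (\<lambda>i. (i, True)) ` {i. (i, True) \<in> A} \<union> (\<lambda>i. (i, False)) ` {i. (i, False) \<in> A}"
    (is "A = ?T \<union> ?F")
  proof (intro equalityI subsetI)
    fix x assume "x \<in> A"
    then show "x \<in> ?T \<union> ?F" by (cases x; cases "snd x") auto
  qed auto
  moreover have "card ?T = nl A" "card ?F = nr A"
    by (auto simp: nl_def nr_def card_image inj_on_def)
  moreover have "card (?T \<union> ?F) = card ?T + card ?F"
    using finite_fibre[OF assms] by (intro card_Un_disjoint) auto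
  ultimately show ?thesis by metis
qed

lemma nl_compl: "A \<subseteq> board m \<Longrightarrow> nl (board m - A) = m - nl A"
proof -
  assume A: "A \<subseteq> board m"
  then have "{i. (i, True) \<in> board m - A} = {..<m} - {i. (i, True) \<in> A}" "{i. (i, True) \<in> A} \<subseteq> {..<m}"
    by (auto simp: board_def)
  then show ?thesis by (simp add: nl_def card_Diff_subset finite_subset)
qed

lemma nr_compl: "A \<subseteq> board m \<Longrightarrow> nr (board m - A) = m - nr A"
proof -
  assume A: "A \<subseteq> board m"
  then have "{i. (i, False) \<in> board m - A} = {..<m} - {i. (i, False) \<in> A}" "{i. (i, False) \<in> A} \<subseteq> {..<m}"
    by (auto simp: board_def)
  then show ?thesis by (simp add: nr_def card_Diff_subset finite_subset)
qed

text \<open>Pairs left-only in the complement are right-only in \<open>A\<close>. Adding the pairs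
  \<open>B\<close> contained in \<open>A\<close> to the left-only or right-only ones gives
  \<open>nl A\<close> or \<open>nr A\<close>.\<close>

lemma ns_compl:
  assumes "A \<subseteq> board m"
  shows "ns (board m - A) + nl A = ns A + nr A"
proof -
  have fin: "finite A" using assms finite_subset finite_board by blast
  define B where "B = {i. (i, True) \<in> A \<and> (i, False) \<in> A}"
  have finB: "finite B" unfolding B_def by (rule finite_subset[OF _ finite_fibre[OF fin, of True]]) auto
  have "nl A = card ({i. (i, True) \<in> A \<and> (i, False) \<notin> A} \<union> B)"
    unfolding nl_def B_def by (rule arg_cong[where f = card]) auto
  then have 1: "nl A = ns A + card B"
    using finB finite_single[OF fin] by (subst (asm) card_Un_disjoint) (auto simp: ns_def B_def)
  have "{i. (i, True) \<in> board m - A \<and> (i, False) \<notin> board m - A} = {i. (i, False) \<in> A} - B"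
    using assms by (auto simp: B_def)
  moreover have "B \<subseteq> {i. (i, False) \<in> A}" by (auto simp: B_def)
  moreover have "card B \<le> nr A"
    unfolding nr_def using finite_fibre[OF fin, of False] by (intro card_mono) (auto simp: B_def)
  ultimately have "ns (board m - A) + card B = nr A"
    using finB by (simp add: ns_def nr_def card_Diff_subset)
  with 1 show ?thesis by simp
qed

lemma nl_le: "A \<subseteq> board m \<Longrightarrow> nl A \<le> m"
proof -
  assume "A \<subseteq> board m"
  then have "{i. (i, True) \<in> A} \<subseteq> {..<m}" by (auto simp: board_def)
  then show ?thesis unfolding nl_def by (metis card_lessThan card_mono finite_lessThan)
qed

lemma nr_le: "A \<subseteq> board m \<Longrightarrow> nr A \<le> m"
proof -
  assume "A \<subseteq> board m"
  then have "{i. (i, False) \<in> A} \<subseteq> {..<m}" by (auto simp: board_def)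
  then show ?thesis unfolding nr_def by (metis card_lessThan card_mono finite_lessThan)
qed

section \<open>Slices and their free points\<close>

definition slice :: "'a set \<Rightarrow> 'a set \<Rightarrow> 'a set \<Rightarrow> nat \<Rightarrow> 'a set \<Rightarrow> bool" where
  "slice G Y W k A \<longleftrightarrow> A \<subseteq> G \<and> card A = k \<and> Y \<subseteq> A \<and> A \<inter> W = {}"

lemma slice_insert:
  assumes "slice G Y W k A" "finite G" "a \<in> G" "a \<notin> W" "a \<notin> A"
  shows "slice G Y W (Suc k) (insert a A)"
  using assms by (auto simp: slice_def finite_subset)

lemma ex_slice:
  assumes "finite G" "Y \<subseteq> G" "W \<subseteq> G" "Y \<inter> W = {}" "card Y \<le> k" "k + card W \<le> card G"
  obtains A where "slice G Y W k A"
proof -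
  have "k \<le> card (G - W)" using assms by (simp add: card_Diff_subset finite_subset)
  moreover have "Y \<subseteq> G - W" using assms by blast
  ultimately obtain A where "Y \<subseteq> A" "A \<subseteq> G - W" "card A = k"
    using exists_subset_between[of Y k "G - W"] assms by auto
  then show thesis by (intro that[of A]) (auto simp: slice_def)
qed

lemma slice_compl:
  assumes "slice G Y W k A" "finite G" "W \<subseteq> G"
  shows "slice G W Y (card G - k) (G - A)"
  using assms by (auto simp: slice_def card_Diff_subset finite_subset)

lemma ex_free_pair:
  assumes "Fr \<subseteq> board m" "m < card Fr"
  obtains i where "(i, True) \<in> Fr" "(i, False) \<in> Fr"
proof -
  have fin: "finite Fr" using assms finite_subset finite_board by blast
  have "fst ` Fr \<subseteq> {..<m}" using assms by (auto simp: board_def)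
  then have "card (fst ` Fr) \<le> m" by (metis card_lessThan card_mono finite_lessThan)
  then have "\<not> inj_on fst Fr" using assms(2) by (metis card_image not_less)
  then obtain x y where "x \<in> Fr" "y \<in> Fr" "fst x = fst y" "x \<noteq> y" by (auto simp: inj_on_def)
  then show thesis using that[of "fst x"] by (cases x; cases y; cases "snd x"; cases "snd y") auto
qed

text \<open>Without a whole pair in \<open>Fr\<close>, the projection to pair indices is injective,
  so \<open>m\<close> points reach all \<open>m\<close> indices.\<close>

lemma free_pairs_unique:
  assumes "Fr \<subseteq> board m" "card Fr = m" "\<And>i. \<not> ((i, True) \<in> Fr \<and> (i, False) \<in> Fr)" "i < m"
  shows "(i, True) \<in> Fr \<longleftrightarrow> (i, False) \<notin> Fr"
proof -
  have fin: "finite Fr" using assms finite_subset finite_board by blast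
  have "inj_on fst Fr"
  proof (rule inj_onI)
    fix x y assume xy: "x \<in> Fr" "y \<in> Fr" "fst x = fst y"
    obtain j b c where "x = (j, b)" "y = (j, c)" using xy(3) by (metis prod.collapse)
    then show "x = y" using xy assms(3)[of j] by (cases b; cases c) auto
  qed
  then have "card (fst ` Fr) = m" using assms(2) card_image by metis
  moreover have "fst ` Fr \<subseteq> {..<m}" using assms by (auto simp: board_def)
  ultimately have "fst ` Fr = {..<m}" by (intro card_subset_eq) auto
  then have "i \<in> fst ` Fr" using assms(4) by simp
  then obtain b where "(i, b) \<in> Fr" by auto
  then show ?thesis using assms(3)[of i] by (cases b) auto
qed

definition lefts :: "nat \<Rightarrow> (nat \<times> bool) set" where
  "lefts m = {..<m} \<times> {True}"

definition rights :: "nat \<Rightarrow> (nat \<times> bool) set" where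
  "rights m = {..<m} \<times> {False}"

lemma lefts_rights_iff [simp]:
  "(i, b) \<in> lefts m \<longleftrightarrow> i < m \<and> b" "(i, b) \<in> rights m \<longleftrightarrow> i < m \<and> \<not> b"
  by (auto simp: lefts_def rights_def)

lemma lefts_rights_subset [simp]: "lefts m \<subseteq> board m" "rights m \<subseteq> board m"
  by (auto simp: lefts_def rights_def board_def)

lemma finite_lefts_rights [simp]: "finite (lefts m)" "finite (rights m)"
  by (auto simp: lefts_def rights_def)

lemma card_lefts_rights [simp]: "card (lefts m) = m" "card (rights m) = m"
  by (auto simp: lefts_def rights_def card_cartesian_product)

lemma nr_eq_0_iff: "A \<subseteq> board m \<Longrightarrow> nr A = 0 \<longleftrightarrow> A \<subseteq> lefts m"
  using finite_subset[OF _ finite_board[of m]]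
  by (auto simp: nr_eq_0 subset_iff board_def lefts_def) (metis (full_types))

lemma nl_eq_0_iff: "A \<subseteq> board m \<Longrightarrow> nl A = 0 \<longleftrightarrow> A \<subseteq> rights m"
  using finite_subset[OF _ finite_board[of m]]
  by (auto simp: nl_eq_0 subset_iff board_def rights_def)

lemma counts_lefts_rights [simp]:
  "nl (lefts m) = m" "nr (lefts m) = 0" "ns (lefts m) = m"
  "nl (rights m) = 0" "nr (rights m) = m" "ns (rights m) = 0"
  by (simp_all add: nl_def nr_def ns_def)

text \<open>Outside pair \<open>i\<close> each side has only \<open>m - 1\<close> points, so a
  one-sided set of that size exhausts its side.\<close>

lemma one_sided_eq:
  assumes "C \<subseteq> board m" "card C = m - 1" "(i, True) \<notin> C" "(i, False) \<notin> C" "i < m"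
    and "nl C = 0 \<or> nr C = 0"
  shows "C = lefts m - {(i, True)} \<or> C = rights m - {(i, False)}"
proof (cases "nr C = 0")
  case True
  then have "C \<subseteq> lefts m - {(i, True)}" using assms(3) nr_eq_0_iff[OF assms(1)] by auto
  then have "C = lefts m - {(i, True)}"
    using assms(2,5) by (intro card_subset_eq) (auto simp: card_Diff_singleton_if)
  then show ?thesis ..
next
  case False
  then have "C \<subseteq> rights m - {(i, False)}" using assms(4,6) nl_eq_0_iff[OF assms(1)] by auto
  then have "C = rights m - {(i, False)}"
    using assms(2,5) by (intro card_subset_eq) (auto simp: card_Diff_singleton_if)
  then show ?thesis ..
qed

lemma counts_lefts_rights_remove:
  assumes "i < m"
  shows "nl (lefts m - {(i, True)}) = m - 1" "nr (lefts m - {(i, True)}) = 0"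
    "ns (lefts m - {(i, True)}) = m - 1"
    "nl (rights m - {(i, False)}) = 0" "nr (rights m - {(i, False)}) = m - 1"
    "ns (rights m - {(i, False)}) = 0"
proof -
  have "{j. j < m \<and> j \<noteq> i} = {..<m} - {i}" by auto
  then have "card {j. j < m \<and> j \<noteq> i} = m - 1" using assms by simp
  then show "nl (lefts m - {(i, True)}) = m - 1" "nr (lefts m - {(i, True)}) = 0"
    "ns (lefts m - {(i, True)}) = m - 1"
    "nl (rights m - {(i, False)}) = 0" "nr (rights m - {(i, False)}) = m - 1"
    "ns (rights m - {(i, False)}) = 0"
    by (simp_all add: nl_def nr_def ns_def)
qed

text \<open>Points of \<open>Y\<close> are forced into the sets considered, points of
  \<open>W\<close> are forbidden, and those in \<open>free\<close> are at choice.\<close>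

locale slices =
  fixes m :: nat and Y W :: "(nat \<times> bool) set"
  assumes Y_sub: "Y \<subseteq> board m" and W_sub: "W \<subseteq> board m" and disj: "Y \<inter> W = {}"
begin

definition free :: "(nat \<times> bool) set" where
  "free = board m - Y - W"

abbreviation sl :: "nat \<Rightarrow> (nat \<times> bool) set \<Rightarrow> bool" where
  "sl \<equiv> slice (board m) Y W"

lemma fin [simp]: "finite Y" "finite W" "finite free"
  using finite_subset[OF Y_sub finite_board] finite_subset[OF W_sub finite_board]
  by (auto simp: free_def)

lemma free_iff: "(i, b) \<in> free \<longleftrightarrow> i < m \<and> (i, b) \<notin> Y \<and> (i, b) \<notin> W"
  by (auto simp: free_def)

lemma not_both: "x \<in> Y \<Longrightarrow> x \<notin> W" "x \<in> W \<Longrightarrow> x \<notin> Y"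
  using disj by auto

lemma Y_less: "(i, b) \<in> Y \<Longrightarrow> i < m" and W_less: "(i, b) \<in> W \<Longrightarrow> i < m"
  using Y_sub W_sub by auto

lemma free_sub: "free \<subseteq> board m"
  by (auto simp: free_def)

lemma card_free: "card free + card Y + card W = 2 * m"
proof -
  have "card (Y \<union> W) = card Y + card W" using disj by (simp add: card_Un_disjoint)
  moreover have "free = board m - (Y \<union> W)" by (auto simp: free_def)
  moreover have "card (Y \<union> W) \<le> card (board m)" using Y_sub W_sub by (intro card_mono) auto
  ultimately show ?thesis using Y_sub W_sub by (simp add: card_Diff_subset)
qed

lemma sl_fin: "sl k A \<Longrightarrow> finite A"
  unfolding slice_def using finite_subset[OF _ finite_board] by metis

lemma sl_sub: "sl k A \<Longrightarrow> A \<subseteq> board m" and sl_Y: "sl k A \<Longrightarrow> x \<in> Y \<Longrightarrow> x \<in> A"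
  and sl_W: "sl k A \<Longrightarrow> x \<in> W \<Longrightarrow> x \<notin> A" and sl_card: "sl k A \<Longrightarrow> card A = k"
  unfolding slice_def by auto

lemma sl_less: "sl k A \<Longrightarrow> (i, b) \<in> A \<Longrightarrow> i < m"
  using sl_sub[of k A] by auto

lemma sl_counts: "sl k A \<Longrightarrow> nl A + nr A = k"
  using card_nl_nr[OF sl_fin] sl_card by simp

lemma sl_insert: "sl k C \<Longrightarrow> a \<in> free \<Longrightarrow> a \<notin> C \<Longrightarrow> sl (Suc k) (insert a C)"
  by (rule slice_insert) (auto simp: free_def)

lemma sl_choose:
  assumes "P \<subseteq> free" "Q \<subseteq> free" "P \<inter> Q = {}" "card Y + card P \<le> k" "k + card W + card Q \<le> 2 * m"
  obtains C where "sl k C" "P \<subseteq> C" "C \<inter> Q = {}"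
proof -
  have fin': "finite P" "finite Q" using assms(1,2) fin finite_subset by blast+
  have "card (Y \<union> P) = card Y + card P" "card (W \<union> Q) = card W + card Q"
    using assms(1,2) fin' by (auto simp: free_def intro!: card_Un_disjoint)
  moreover have "Y \<union> P \<subseteq> board m" "W \<union> Q \<subseteq> board m" "(Y \<union> P) \<inter> (W \<union> Q) = {}"
    using assms(1-3) Y_sub W_sub disj by (auto simp: free_def)
  ultimately obtain C where C: "slice (board m) (Y \<union> P) (W \<union> Q) k C"
    using ex_slice[of "board m" "Y \<union> P" "W \<union> Q" k] assms by (metis card_board finite_board add.assoc)
  show thesis
    by (rule that[of C]) (use C in \<open>auto simp: slice_def\<close>)
qed

text \<open>Supplies the common part \<open>C\<close> of two sets \<open>insert a C\<close> and
  \<open>insert b C\<close> of the next larger slice, on which a selector is then compared.\<close>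

lemma sl_avoid:
  assumes "a \<in> free" "b \<in> free" "a \<noteq> b" "card Y \<le> k" "k + card W + 2 \<le> 2 * m"
  obtains C where "sl k C" "a \<notin> C" "b \<notin> C"
proof -
  have "{} \<subseteq> free" "{a, b} \<subseteq> free" "{} \<inter> {a, b} = {}" "card Y + card {} \<le> k"
    "k + card W + card {a, b} \<le> 2 * m"
    using assms by auto
  then obtain C where "sl k C" "C \<inter> {a, b} = {}" by (rule sl_choose)
  then show thesis by (intro that[of C]) auto
qed

lemma free_partner:
  assumes "\<And>i. \<not> ((i, True) \<in> free \<and> (i, False) \<in> free)" "card free = m" "(i, b) \<in> Y \<union> W"
  shows "(i, \<not> b) \<in> free"
proof -
  have "i < m" using assms(3) Y_less W_less by blast
  then have "(i, True) \<in> free \<longleftrightarrow> (i, False) \<notin> free"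
    using free_pairs_unique[OF free_sub] assms by blast
  then show ?thesis using assms(3) by (cases b) (auto simp: free_iff)
qed

text \<open>A point of \<open>Y\<close> and a point of \<open>W\<close> are always on different
  sides; as both sets are nonempty, each of them is confined to one side.\<close>

lemma one_sided:
  assumes "\<And>i j b. \<lbrakk>(i, b) \<in> Y; (j, b) \<in> W\<rbrakk> \<Longrightarrow> False" and "Y \<noteq> {}" "W \<noteq> {}"
  obtains (right_left) i j where "Y \<subseteq> rights m" "W \<subseteq> lefts m" "(i, False) \<in> Y" "(j, True) \<in> W"
    | (left_right) i j where "Y \<subseteq> lefts m" "W \<subseteq> rights m" "(i, True) \<in> Y" "(j, False) \<in> W"
proof -
  obtain i b where ib: "(i, b) \<in> Y" using assms(2) by fastforce
  obtain j c where jc: "(j, c) \<in> W" using assms(3) by fastforce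
  have c: "c \<longleftrightarrow> \<not> b" using assms(1) ib jc by (cases b; cases c) auto
  have Yb: "(k, e) \<in> Y \<Longrightarrow> e = b" for k e using assms(1)[of k e j] jc c by (cases b; cases e) auto
  have Wc: "(k, e) \<in> W \<Longrightarrow> e = c" for k e using assms(1)[of i b k] ib c by (cases b; cases e) auto
  show thesis
  proof (cases b)
    case True
    have "Y \<subseteq> lefts m" using Yb Y_less True by fastforce
    moreover have "W \<subseteq> rights m" using Wc W_less c True by fastforce
    ultimately show thesis using left_right ib jc c True by simp
  next
    case False
    have "Y \<subseteq> rights m" using Yb Y_less False by fastforce
    moreover have "W \<subseteq> lefts m" using Wc W_less c False by fastforce
    ultimately show thesis using right_left ib jc c False by simp
  qed
qed

end

subsection \<open>The selector for odd dimension\<close>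

definition odd_sel :: "(nat \<times> bool) set \<Rightarrow> bool" where
  "odd_sel A \<longleftrightarrow> (even (ns A) \<longleftrightarrow> nl A \<noteq> 0 \<and> nr A \<noteq> 0)"

text \<open>Complementation exchanges \<open>nl\<close> and \<open>nr\<close>, which preserves the
  flip, and changes the parity of \<open>ns\<close> because \<open>d\<close> is odd.\<close>

lemma odd_sel_compl:
  assumes "odd d" "A \<subseteq> board d" "card A = d"
  shows "odd_sel (board d - A) \<longleftrightarrow> \<not> odd_sel A"
proof -
  have "finite A" using assms(2) finite_subset finite_board by blast
  then have s: "nl A + nr A = d" using card_nl_nr assms(3) by metis
  have "nl (board d - A) = nr A" "nr (board d - A) = nl A"
    using s nl_compl[OF assms(2)] nr_compl[OF assms(2)] by auto
  moreover have "even (ns (board d - A) + nl A) = even (ns A + nr A)" using ns_compl[OF assms(2)] by simp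
  moreover have "odd (nl A + nr A)" using assms(1) s by simp
  ultimately show ?thesis unfolding odd_sel_def by auto
qed

text \<open>Constancy forces equal values whenever one free point is exchanged for another, and
  exchanges that change the selector are sought. The sizes excluded by \<open>card W < m - 1\<close>
  are later reached by complementation.\<close>

lemma (in slices) odd_sel_not_constant:
  assumes m: "odd m" "m \<ge> 3"
    and YW: "Y \<noteq> {}" "W \<noteq> {}" "card Y + card W = m" "card W < m - 1"
    and const: "\<And>A. sl m A \<Longrightarrow> odd_sel A = v"
  shows False
proof -
  have pos: "card Y > 0" "card W > 0" using YW(1,2) by (auto simp: card_gt_0_iff)
  have card_free': "card free = m" using card_free YW(3) by simp
  have swap: "odd_sel (insert a C) = odd_sel (insert b C)"
    if "sl (m - 1) C" "a \<in> free" "a \<notin> C" "b \<in> free" "b \<notin> C" for a b C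
    using const sl_insert[OF that(1,2,3)] sl_insert[OF that(1,4,5)] m by simp
  show False
  proof (cases "\<exists>i. (i, True) \<in> free \<and> (i, False) \<in> free")
    case True
    then obtain i where i: "(i, True) \<in> free" "(i, False) \<in> free" by blast
    have im: "i < m" using i by (simp add: free_iff)
    \<comment> \<open>The left and the right point of a free pair affect the parity of
      \<open>ns\<close> differently, so equal values require the flip to interfere, that is,
      \<open>C\<close> to be one-sided.\<close>
    have one: "C = lefts m - {(i, True)} \<or> C = rights m - {(i, False)}"
      if C: "sl (m - 1) C" "(i, True) \<notin> C" "(i, False) \<notin> C" for C
    proof (rule one_sided_eq[OF sl_sub[OF C(1)] sl_card[OF C(1)] C(2,3) im])
      show "nl C = 0 \<or> nr C = 0"
        using swap[OF C(1) i(1) C(2) i(2) C(3)] C sl_fin[OF C(1)]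
        by (auto simp: odd_sel_def even_ns_insert)
    qed
    show False
    proof (cases "card Y = m - 1")
      case False
      have "card (free - {(i, True), (i, False)}) = m - 2"
        using i card_free' by (simp add: card_Diff_subset)
      then have "\<not> card (free - {(i, True), (i, False)}) \<le> Suc 0"
        using False YW pos by linarith
      \<comment> \<open>Two more free points extend one \<open>C\<close> to sets that both have to
        exhaust a side; the nonempty \<open>C\<close> fixes the side, but the two extensions
        differ.\<close>
      then obtain a b where ab: "a \<in> free - {(i, True), (i, False)}"
          "b \<in> free - {(i, True), (i, False)}" "a \<noteq> b"
        using card_le_Suc0_iff_eq by (metis finite_Diff fin(3))
      have "card Y \<le> m - 2" "m - 2 + card W + card {(i, True), (i, False), a, b} \<le> 2 * m"
        using False YW pos ab by auto
      then obtain C where C: "sl (m - 2) C" "C \<inter> {(i, True), (i, False), a, b} = {}"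
        using sl_choose[of "{}" "{(i, True), (i, False), a, b}" "m - 2"] i ab by auto
      have ins: "sl (m - 1) (insert c C)" if "c \<in> {a, b}" for c
        using sl_insert[OF C(1), of c] that C(2) ab m by (auto simp: Suc_diff_Suc numeral_2_eq_2)
      have "insert c C = lefts m - {(i, True)} \<or> insert c C = rights m - {(i, False)}" if "c \<in> {a, b}" for c
        by (rule one[OF ins[OF that]]) (use that ab C(2) in auto)
      then have "insert a C = lefts m - {(i, True)} \<or> insert a C = rights m - {(i, False)}"
        "insert b C = lefts m - {(i, True)} \<or> insert b C = rights m - {(i, False)}" by auto
      moreover have "C \<noteq> {}" using sl_card[OF C(1)] m by auto
      then obtain x where "x \<in> C" by blast
      moreover have "b \<notin> insert a C" using C(2) ab by auto
      moreover have "lefts m \<inter> rights m = {}" by auto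
      ultimately show False by blast
    next
      case True
      have iY: "(i, True) \<notin> Y" "(i, False) \<notin> Y" using i by (auto simp: free_iff)
      have Y: "sl (m - 1) Y" using Y_sub disj True by (auto simp: slice_def)
      have "card W = 1" using YW True m by simp
      then obtain w where w: "W = {w}" by (auto simp: card_1_singleton_iff)
      \<comment> \<open>A third pair \<open>k\<close> exists since \<open>m \<ge> 3\<close>.
        Completing it, instead of filling the gap at \<open>i\<close>, gives the same parity of
        \<open>ns\<close> but a set that is not one-sided.\<close>
      have "\<not> {..<m} \<subseteq> {i, fst w}"
      proof
        assume "{..<m} \<subseteq> {i, fst w}"
        then have "card {..<m} \<le> card {i, fst w}" by (intro card_mono) auto
        also have "\<dots> \<le> 2" by (simp add: card_insert_if)
        finally show False using m by simp
      qed
      then obtain k where k: "k < m" "k \<noteq> i" "k \<noteq> fst w" by auto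
      note counts = counts_lefts_rights_remove[OF im]
      from one[OF Y iY] show False
      proof
        assume Yeq: "Y = lefts m - {(i, True)}"
        have kY: "(k, False) \<notin> Y" using Yeq by auto
        moreover have "(k, False) \<in> free" unfolding free_iff using kY k w by auto
        ultimately have "(k, False) \<in> free" "(k, False) \<notin> Y" by auto
        moreover have "(k, True) \<in> Y" using Yeq k by auto
        ultimately show False
          using swap[OF Y i(1) iY(1), of "(k, False)"] counts(1-3)[folded Yeq] m iY
          by (auto simp: odd_sel_def even_ns_insert)
      next
        assume Yeq: "Y = rights m - {(i, False)}"
        have kY: "(k, True) \<notin> Y" using Yeq by auto
        moreover have "(k, True) \<in> free" unfolding free_iff using kY k w by auto
        ultimately have "(k, True) \<in> free" "(k, True) \<notin> Y" by auto
        moreover have "(k, False) \<in> Y" using Yeq k by auto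
        ultimately show False
          using swap[OF Y i(2) iY(2), of "(k, True)"] counts(4-6)[folded Yeq] m iY
          by (auto simp: odd_sel_def even_ns_insert)
      qed
    qed
  next
    case False
    then have partner: "(i, \<not> b) \<in> free" if "(i, b) \<in> Y \<union> W" for i b
      using free_partner card_free' that by blast
    \<comment> \<open>One of the two free partners completes a pair and the other does not, so the
      parities differ, while both results meet both sides.\<close>
    have no_mix: False if ij: "(i, b) \<in> Y" "(j, b) \<in> W" for i j b
    proof -
      have fr: "(i, \<not> b) \<in> free" "(j, \<not> b) \<in> free" using partner ij by auto
      have "(i, \<not> b) \<noteq> (j, \<not> b)" using ij not_both by blast
      moreover have "card Y \<le> m - 1" "m - 1 + card W + 2 \<le> 2 * m" using YW(3) pos by linarith+
      ultimately obtain C where C: "sl (m - 1) C" "(i, \<not> b) \<notin> C" "(j, \<not> b) \<notin> C"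
        by (rule sl_avoid[OF fr])
      have mem: "(i, b) \<in> C" "(j, b) \<notin> C" using C ij sl_Y sl_W by auto
      have "nl C \<noteq> 0" if b using mem that nl_eq_0 sl_fin[OF C(1)] by auto
      moreover have "nr C \<noteq> 0" if "\<not> b" using mem that nr_eq_0 sl_fin[OF C(1)] by auto
      ultimately show False
        using swap[OF C(1) fr(1) C(2) fr(2) C(3)] C mem sl_fin[OF C(1)]
        by (cases b) (auto simp: odd_sel_def even_ns_insert)
    qed
    show False
    proof (rule one_sided[OF _ YW(1,2)])
      fix i j b assume "(i, b) \<in> Y" "(j, b) \<in> W"
      then show False by (rule no_mix)
    next
      fix i j assume 1: "Y \<subseteq> rights m" "W \<subseteq> lefts m" "(i, False) \<in> Y" "(j, True) \<in> W"
      note ij = 1(3,4)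
      have fr: "(i, True) \<in> free" "(j, False) \<in> free" using partner[of i False] partner[of j True] ij by auto
      have ne: "i \<noteq> j" and jm: "j < m" using ij fr by (auto simp: free_iff)
      \<comment> \<open>The full right side is a member of the slice and is flipped; exchanging
        \<open>(j, False)\<close> for \<open>(i, True)\<close> keeps \<open>ns = 0\<close> and
        removes the flip.\<close>
      define C where "C = rights m - {(j, False)}"
      have C: "sl (m - 1) C"
        using 1 fr by (auto simp: C_def slice_def free_iff card_Diff_singleton_if)
      have mem: "(i, True) \<notin> C" "(j, False) \<notin> C" "(i, False) \<in> C" "(j, True) \<notin> C"
        using ne Y_less[OF ij(1)] by (auto simp: C_def)
      show False
        using swap[OF C fr(1) mem(1) fr(2) mem(2)] counts_lefts_rights_remove(4-6)[OF jm, folded C_def]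
          m mem sl_fin[OF C]
        by (auto simp: odd_sel_def even_ns_insert)
    next
      fix i j assume 2: "Y \<subseteq> lefts m" "W \<subseteq> rights m" "(i, True) \<in> Y" "(j, False) \<in> W"
      note ij = 2(3,4)
      have fr: "(i, False) \<in> free" "(j, True) \<in> free" using partner[of i True] partner[of j False] ij by auto
      have ne: "i \<noteq> j" and jm: "j < m" using ij fr by (auto simp: free_iff)
      define C where "C = lefts m - {(j, True)}"
      have C: "sl (m - 1) C"
        using 2 fr by (auto simp: C_def slice_def free_iff card_Diff_singleton_if)
      have mem: "(i, False) \<notin> C" "(j, True) \<notin> C" "(i, True) \<in> C" "(j, False) \<notin> C"
        using ne Y_less[OF ij(1)] by (auto simp: C_def)
      show False
        using swap[OF C fr(1) mem(1) fr(2) mem(2)] counts_lefts_rights_remove(1-3)[OF jm, folded C_def]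
          m mem sl_fin[OF C]
        by (auto simp: odd_sel_def even_ns_insert)
    qed
  qed
qed

subsection \<open>The four parts of the selector for even dimension\<close>

lemma nl_pos: "finite A \<Longrightarrow> (i, True) \<in> A \<Longrightarrow> nl A \<noteq> 0"
  using nl_eq_0[of A] by auto

lemma nr_pos: "finite A \<Longrightarrow> (i, False) \<in> A \<Longrightarrow> nr A \<noteq> 0"
  using nr_eq_0[of A] by auto

lemma nr_ge_2:
  assumes "finite A" "(i, False) \<in> A" "(j, False) \<in> A" "i \<noteq> j"
  shows "nr A \<ge> 2"
proof -
  have "card {i, j} \<le> nr A"
    unfolding nr_def by (rule card_mono) (use assms finite_fibre[OF assms(1)] in auto)
  then show ?thesis using assms(4) by simp
qed

lemma obtain_left:
  assumes "finite A" "card F < nl A" "finite F"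
  obtains k where "(k, True) \<in> A" "k \<notin> F"
proof -
  have "\<not> {i. (i, True) \<in> A} \<subseteq> F"
    using assms card_mono[OF assms(3)] unfolding nl_def by (metis not_le)
  then show thesis using that by auto
qed

lemma obtain_right:
  assumes "finite A" "card F < nr A" "finite F"
  obtains k where "(k, False) \<in> A" "k \<notin> F"
proof -
  have "\<not> {i. (i, False) \<in> A} \<subseteq> F"
    using assms card_mono[OF assms(3)] unfolding nr_def by (metis not_le)
  then show thesis using that by auto
qed

lemma nr_eq_1_iff:
  assumes "finite A" "nr A = 1" "(i, False) \<in> A" "(j, False) \<in> A"
  shows "i = j"
  using nr_ge_2[OF assms(1,3,4)] assms(2) by force

text \<open>For odd \<open>m\<close>, \<open>selK\<close> is applied to sets of size
  \<open>m - 1\<close>, \<open>selP\<close> and \<open>selQ\<close> to size \<open>m\<close>, and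
  \<open>selN\<close> to size \<open>m + 1\<close>. The exceptional clauses are matched so that
  complementation in \<open>board m\<close> exchanges \<open>selK\<close> with the negation of
  \<open>selN\<close>, and \<open>selP\<close> with the negation of \<open>selQ\<close>.\<close>

definition selK :: "(nat \<times> bool) set \<Rightarrow> bool" where
  "selK B \<longleftrightarrow> (if nr B \<le> 1 then nr B = 1 else even (ns B))"

definition selP :: "(nat \<times> bool) set \<Rightarrow> bool" where
  "selP B \<longleftrightarrow> even (ns B) \<noteq> (nr B \<le> 1 \<or> nl B = 0)"

definition selQ :: "(nat \<times> bool) set \<Rightarrow> bool" where
  "selQ B \<longleftrightarrow> even (ns B) \<noteq> (nl B \<le> 1 \<or> nr B = 0)"

definition selN :: "(nat \<times> bool) set \<Rightarrow> bool" where
  "selN B \<longleftrightarrow> (if nl B \<le> 2 then nl B = 1 else odd (ns B))"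

section \<open>Slices on which \<open>selP\<close> is constant\<close>

context slices
begin

lemma sides:
  assumes "F \<subseteq> free"
  obtains (mixed) j k where "(j, True) \<in> F" "(k, False) \<in> F"
    | (left) "\<And>j. (j, False) \<notin> F" | (right) "\<And>j. (j, True) \<notin> F"
  using assms by blast

lemma selP_swap:
  assumes "\<forall>A. sl m A \<longrightarrow> selP A = v" "m \<ge> 1"
    and "sl (m - 1) C" "a \<in> free" "a \<notin> C" "b \<in> free" "b \<notin> C"
  shows "selP (insert a C) = selP (insert b C)"
  using assms(1) sl_insert[OF assms(3-5)] sl_insert[OF assms(3,6,7)] assms(2) by simp

text \<open>The two points of a free pair lead to different parities of \<open>ns\<close>. Equal
  values thus need exactly one of the two extensions to be exceptional, which leaves these shapes of
  \<open>C\<close>.\<close>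

lemma selP_pair:
  assumes "\<forall>A. sl m A \<longrightarrow> selP A = v" "m \<ge> 5"
    and "sl (m - 1) C" "(i, True) \<in> free" "(i, True) \<notin> C" "(i, False) \<in> free" "(i, False) \<notin> C"
  shows "nr C = 1 \<or> nl C = 0"
proof -
  have "selP (insert (i, True) C) = selP (insert (i, False) C)"
    by (rule selP_swap[OF assms(1)]) (use assms in auto)
  then show ?thesis
    using sl_counts[OF assms(3)] sl_fin[OF assms(3)] assms(2,5,7)
    by (auto simp: selP_def even_ns_insert)
qed

text \<open>\<open>selP_pair\<close> is applied to two extensions of one \<open>C\<close>: adding
  \<open>(j, True)\<close> forces \<open>nr C = 1\<close>, adding \<open>(k, False)\<close> forces
  \<open>nr C = 0\<close> or \<open>nl C = 0\<close>. A set of size \<open>m - 2\<close> cannot meet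
  both demands.\<close>

lemma selP_mixed_pair:
  assumes "\<forall>A. sl m A \<longrightarrow> selP A = v" "m \<ge> 5" "card Y \<le> m - 2" "card W \<le> m - 2"
    and i: "(i, True) \<in> free" "(i, False) \<in> free"
    and jk: "(j, True) \<in> free" "(k, False) \<in> free" "j \<noteq> i" "k \<noteq> i"
  shows False
proof -
  let ?F = "{(i, True), (i, False), (j, True), (k, False)}"
  have "{} \<subseteq> free" "?F \<subseteq> free" "{} \<inter> ?F = {}" "card Y + card {} \<le> m - 2"
      "m - 2 + card W + card ?F \<le> 2 * m"
    using assms by auto
  then obtain C where C: "sl (m - 2) C" "C \<inter> ?F = {}" by (rule sl_choose)
  have "Suc (m - 2) = m - 1" using assms(2) by simp
  then have sl: "sl (m - 1) (insert (j, True) C)" "sl (m - 1) (insert (k, False) C)"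
    using sl_insert[OF C(1) jk(1)] sl_insert[OF C(1) jk(2)] C(2) by auto
  have "nr (insert (j, True) C) = 1 \<or> nl (insert (j, True) C) = 0"
    by (rule selP_pair[OF assms(1,2) sl(1) i(1) _ i(2)]) (use C(2) jk in auto)
  moreover have "nr (insert (k, False) C) = 1 \<or> nl (insert (k, False) C) = 0"
    by (rule selP_pair[OF assms(1,2) sl(2) i(1) _ i(2)]) (use C(2) jk in auto)
  ultimately show False
    using C sl_counts[OF C(1)] sl_fin[OF C(1)] assms(2) by auto
qed

lemma selP_unflipped:
  assumes "\<forall>A. sl m A \<longrightarrow> selP A = v" "m \<ge> 5" "sl (m - 1) C"
    and "a \<in> free" "a \<notin> C" "b \<in> free" "b \<notin> C"
    and "nr (insert a C) \<ge> 2" "nr (insert b C) \<ge> 2" "nl (insert a C) \<noteq> 0" "nl (insert b C) \<noteq> 0"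
  shows "even (ns (insert a C)) = even (ns (insert b C))"
proof -
  have "selP (insert a C) = selP (insert b C)"
    by (rule selP_swap[OF assms(1)]) (use assms in auto)
  then show ?thesis using assms(8-11) by (auto simp: selP_def)
qed

text \<open>Only one of the two right points completes a pair, so the parities of \<open>ns\<close>
  differ, and neither result is exceptional.\<close>

lemma selP_two_rights:
  assumes "\<forall>A. sl m A \<longrightarrow> selP A = v" "m \<ge> 5" "sl (m - 1) C"
    and "(i, False) \<in> free" "(i, False) \<notin> C" "(i, True) \<notin> C"
    and "(k, False) \<in> free" "(k, False) \<notin> C" "(k, True) \<in> C" "nr C \<noteq> 0"
  shows False
proof -
  note f = sl_fin[OF assms(3)]
  have "even (ns (insert (i, False) C)) = even (ns (insert (k, False) C))"
    by (rule selP_unflipped[OF assms(1,2,3)]) (use assms f nl_pos[OF f assms(9)] in auto)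
  then show False using assms f by (simp add: even_ns_insert)
qed

text \<open>Both extensions have the same right points and some left point, so both or neither are
  exceptional, but the parities of \<open>ns\<close> differ.\<close>

lemma selP_two_lefts:
  assumes "\<forall>A. sl m A \<longrightarrow> selP A = v" "m \<ge> 5" "sl (m - 1) C"
    and "(i, True) \<in> free" "(i, True) \<notin> C" "(i, False) \<in> C"
    and "(k, True) \<in> free" "(k, True) \<notin> C" "(k, False) \<notin> C"
  shows False
proof -
  have "selP (insert (i, True) C) = selP (insert (k, True) C)"
    by (rule selP_swap[OF assms(1)]) (use assms in auto)
  then show False using assms sl_fin[OF assms(3)] by (auto simp: selP_def even_ns_insert)
qed

text \<open>Compares \<open>rights m\<close>, which is exceptional, with a set of one left and
  \<open>m - 1\<close> right points, which is not; both have \<open>ns = 0\<close>.\<close>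

lemma selP_all_rights:
  assumes "\<forall>A. sl m A \<longrightarrow> selP A = v" "m \<ge> 5" "k < m" "sl (m - 1) (rights m - {(k, False)})"
    and "(k, False) \<in> free" "(i, True) \<in> free" "i \<noteq> k"
  shows False
proof -
  define C where "C = rights m - {(k, False)}"
  have mem: "(k, False) \<notin> C" "(i, True) \<notin> C" "(k, True) \<notin> C" "(i, False) \<in> C"
    using assms(5-7) by (auto simp: C_def free_iff)
  have "selP (insert (k, False) C) = selP (insert (i, True) C)"
    by (rule selP_swap[OF assms(1)]) (use assms mem C_def in auto)
  then show False
    using mem sl_fin[OF assms(4), folded C_def] counts_lefts_rights_remove(4-6)[OF assms(3), folded C_def] assms(2)
    by (simp add: selP_def even_ns_insert)
qed

end

context slices
begin

lemma card_Y_left: "card Y = nl Y + nr Y"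
  by (rule card_nl_nr) simp

text \<open>Any \<open>C\<close> that avoids the free pair has a shape given by
  \<open>selP_pair\<close>. For each shape an exchange is found that one of the preceding lemmas
  forbids; the extreme sizes of \<open>Y\<close> and \<open>W\<close> are separate because they
  leave hardly any choice of \<open>C\<close>.\<close>

lemma selP_no_free_pair:
  assumes const: "\<forall>A. sl m A \<longrightarrow> selP A = v" and m: "m \<ge> 5"
    and YW: "card Y + card W \<le> m" "card Y \<le> m - 1" "card W \<le> m - 1"
    and i: "(i, True) \<in> free" "(i, False) \<in> free"
  shows False
proof -
  define F where "F = free - {(i, True), (i, False)}"
  have im: "i < m" and iY: "(i, True) \<notin> Y" "(i, False) \<notin> Y" using i by (auto simp: free_iff)
  have F_free: "F \<subseteq> free" and finF: "finite F" by (auto simp: F_def)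
  have card_F: "card F + card Y + card W + 2 = 2 * m"
  proof -
    have "card F = card free - 2" using i by (simp add: F_def card_Diff_subset)
    moreover have "card {(i, True), (i, False)} \<le> card free" using i by (intro card_mono) auto
    ultimately show ?thesis using card_free by simp
  qed
  note pair = selP_pair[OF const m _ i(1) _ i(2)]
  consider (Y) "card Y = m - 1" "card W \<le> 1" | (W) "card W = m - 1" "card Y \<le> 1"
    | (mid) "card Y \<le> m - 2" "card W \<le> m - 2"
    using YW m by linarith
  then show False
  proof cases
    case Y
    have sl: "sl (m - 1) Y" using Y(1) Y_sub disj by (auto simp: slice_def)
    have card_fst: "card (fst ` W) \<le> 1" using card_image_le[of W fst] Y(2) by simp
    from pair[OF sl iY] show False
    proof
      assume nr: "nr Y = 1"
      then have nl: "nl Y = m - 2" using card_Y_left Y(1) by simp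
      obtain j where j: "(j, False) \<in> Y" using obtain_right[of Y "{}"] nr by auto
      have "card (insert j (fst ` W)) \<le> 2" using card_fst by (simp add: card_insert_if)
      then have lt: "card (insert j (fst ` W)) < nl Y" using nl m by linarith
      \<comment> \<open>At most two indices are excluded, while \<open>Y\<close> has
        \<open>m - 2 \<ge> 3\<close> left points; the partner of the chosen one is free.\<close>
      obtain k where k: "(k, True) \<in> Y" "k \<notin> insert j (fst ` W)"
        by (rule obtain_left[OF _ lt]) auto
      have kF: "(k, False) \<notin> Y" using nr_eq_1_iff[OF _ nr _ j] k by auto
      have "(k, False) \<in> free" using kF k Y_less by (force simp: free_iff)
      then show False
        by (intro selP_two_rights[OF const m sl i(2) iY(2,1) _ kF k(1)]) (use nr in auto)
    next
      assume "nl Y = 0"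
      then have Yeq: "Y = rights m - {(i, False)}"
        using one_sided_eq[OF Y_sub Y(1) iY im] counts_lefts_rights_remove(1)[OF im] m by auto
      have "card (insert i (fst ` W)) \<le> 2" using card_fst by (simp add: card_insert_if)
      then have "card (insert i (fst ` W)) < card {..<m}" using m by simp
      then have "\<not> {..<m} \<subseteq> insert i (fst ` W)" by (metis card_mono finite_imageI finite_insert fin(2) not_le)
      then obtain k where k: "k < m" "k \<notin> insert i (fst ` W)" by auto
      have "(k, True) \<notin> Y" using Yeq by auto
      then have "(k, True) \<in> free" using k by (force simp: free_iff)
      then show False
        using selP_all_rights[OF const m im _ i(2), of k] sl Yeq k by auto
    qed
  next
    case W
    \<comment> \<open>As \<open>card W = m - 1\<close>, exactly \<open>m - 1\<close> points lie
      outside \<open>W\<close> and pair \<open>i\<close>, so \<open>C\<close> is determined.\<close>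
    define C where "C = Y \<union> F"
    have "card C = m - 1"
      unfolding C_def using card_F W(1) finF by (subst card_Un_disjoint) (auto simp: F_def free_def)
    then have sl: "sl (m - 1) C"
      using Y_sub disj free_sub by (auto simp: slice_def C_def F_def free_def)
    have iC: "(i, True) \<notin> C" "(i, False) \<notin> C" using iY by (auto simp: C_def F_def)
    have card_fst: "card (fst ` Y) \<le> 1" using card_image_le[of Y fst] W(2) by simp
    from pair[OF sl iC] show False
    proof
      assume nr: "nr C = 1"
      then have nl: "nl C = m - 2" using sl_counts[OF sl] by simp
      obtain j where j: "(j, False) \<in> C" using obtain_right[of C "{}"] nr sl_fin[OF sl] by auto
      have "card (insert j (fst ` Y)) \<le> 2" using card_fst by (simp add: card_insert_if)
      then have lt: "card (insert j (fst ` Y)) < nl C" using nl m by linarith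
      obtain k where k: "(k, True) \<in> C" "k \<notin> insert j (fst ` Y)"
        by (rule obtain_left[OF sl_fin[OF sl] lt]) auto
      have kF: "(k, False) \<notin> C" using nr_eq_1_iff[OF sl_fin[OF sl] nr _ j] k by auto
      have ki: "k \<noteq> i" using k iC by auto
      have "(k, True) \<notin> Y" using k(2) by force
      then have k_free: "(k, True) \<in> free" "(k, True) \<in> F" using k(1) by (auto simp: C_def F_def)
      \<comment> \<open>The exchange prepares \<open>selP_two_lefts\<close>: in \<open>D\<close>,
        pair \<open>i\<close> lacks only its left point, and pair \<open>k\<close> is empty.\<close>
      define D where "D = insert (i, False) (C - {(k, True)})"
      have "card D = m - 1" using k(1) sl_card[OF sl] iC sl_fin[OF sl] m by (simp add: D_def)
      then have slD: "sl (m - 1) D"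
        using sl i(2) \<open>(k, True) \<notin> Y\<close> by (auto simp: slice_def D_def free_iff)
      show False
        by (rule selP_two_lefts[OF const m slD i(1) _ _ k_free(1)])
          (use iC kF ki in \<open>auto simp: D_def\<close>)
    next
      assume "nl C = 0"
      then have Ceq: "C = rights m - {(i, False)}"
        using one_sided_eq[OF sl_sub[OF sl] sl_card[OF sl] iC im] counts_lefts_rights_remove(1)[OF im] m by auto
      have "F \<noteq> {}" using card_F W m by auto
      then obtain x where x: "x \<in> F" by blast
      then have "x \<in> rights m - {(i, False)}" unfolding Ceq[symmetric] C_def by simp
      then obtain k where k: "x = (k, False)" "k < m" "k \<noteq> i" by (cases x) auto
      have "sl (m - 1) (rights m - {(k, False)})"
      proof -
        have eq: "rights m = insert (i, False) C" using Ceq im by auto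
        have "(k, False) \<notin> Y" using x k by (auto simp: F_def free_iff)
        then have 1: "Y \<subseteq> rights m - {(k, False)}" using eq by (auto simp: C_def)
        have "(i, False) \<notin> W" using i by (simp add: free_iff)
        moreover have "C \<inter> W = {}" using sl by (simp add: slice_def)
        ultimately have 2: "(rights m - {(k, False)}) \<inter> W = {}" unfolding eq by auto
        have 3: "rights m - {(k, False)} \<subseteq> board m" by auto
        have "card (rights m - {(k, False)}) = m - 1" using k by simp
        with 1 2 3 show ?thesis by (simp add: slice_def)
      qed
      then show False
        using selP_all_rights[OF const m k(2) _ _ i(1)] x k by (auto simp: F_def)
    qed
  next
    case mid
    have "{} \<subseteq> free" "{(i, True), (i, False)} \<subseteq> free" "{} \<inter> {(i, True), (i, False)} = {}"
      "card Y + card {} \<le> m - 1" "m - 1 + card W + card {(i, True), (i, False)} \<le> 2 * m"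
      using i mid m by auto
    then obtain C where C: "sl (m - 1) C" "C \<inter> {(i, True), (i, False)} = {}" by (rule sl_choose)
    have iC: "(i, True) \<notin> C" "(i, False) \<notin> C" using C(2) by auto
    have C_sub: "C \<subseteq> Y \<union> F" using C by (auto simp: slice_def F_def free_def)
    have finC: "finite C" by (rule sl_fin[OF C(1)])
    have card_CY: "card (C - Y) = m - 1 - card Y"
      using C(1) by (simp add: slice_def card_Diff_subset)
    then have "card (C - Y) \<noteq> 0" using mid m by linarith
    then have "C - Y \<noteq> {}" by (metis card.empty)
    then obtain c where c: "c \<in> C" "c \<notin> Y" "c \<in> F" using C_sub by blast
    note p = pair[OF C(1) iC]
    from F_free show False
    proof (rule sides)
      fix j k assume "(j, True) \<in> F" "(k, False) \<in> F"
      then show False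
        by (intro selP_mixed_pair[OF const m mid i, of j k]) (auto simp: F_def)
    next
      assume left: "\<And>j. (j, False) \<notin> F"
      have "snd c" using left c by (cases c; cases "snd c") auto
      then have "nl C \<noteq> 0" using nl_pos[OF finC, of "fst c"] c by (cases c) auto
      then have nr: "nr C = 1" using p by simp
      then obtain j where j: "(j, False) \<in> C" using obtain_right[of C "{}"] finC by auto
      have "nl F = card F" using card_nl_nr[OF finF] nr_eq_0[OF finF] left by simp
      then have "1 < nl F" using card_F YW(1) m by linarith
      then obtain k where k: "(k, True) \<in> F" "k \<noteq> j" using obtain_left[OF finF, of "{j}"] by auto
      have ki: "k \<noteq> i" and k_free: "(k, True) \<in> free" using k by (auto simp: F_def)
      have kF: "(k, False) \<notin> Y" "(k, False) \<notin> free"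
        using nr_eq_1_iff[OF finC nr _ j] sl_Y[OF C(1)] k left[of k] ki by (auto simp: F_def)
      have "{(i, False)} \<subseteq> free" "{(i, True), (k, True)} \<subseteq> free" "{(i, False)} \<inter> {(i, True), (k, True)} = {}"
        "card Y + card {(i, False)} \<le> m - 1" "m - 1 + card W + card {(i, True), (k, True)} \<le> 2 * m"
        using i k_free ki mid m by auto
      then obtain D where D: "sl (m - 1) D" "{(i, False)} \<subseteq> D" "D \<inter> {(i, True), (k, True)} = {}"
        by (rule sl_choose)
      have "(k, False) \<notin> D" using kF D(1) by (auto simp: slice_def free_def)
      then show False
        by (intro selP_two_lefts[OF const m D(1) i(1) _ _ k_free]) (use D in auto)
    next
      assume right: "\<And>j. (j, True) \<notin> F"
      have nrF: "nr F = card F" using card_nl_nr[OF finF] nl_eq_0[OF finF] right by simp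
      have card3: "card F \<ge> 3" "card Y + card F \<ge> m" using card_F YW(1) mid m by linarith+
      have finCY: "finite (C - Y)" using finC by simp
      have CYr: "nl (C - Y) = 0" using right C_sub by (auto simp: nl_eq_0[OF finCY])
      have idx_F: "{l. (l, False) \<in> F} \<subseteq> {..<m} - {i}" by (auto simp: F_def free_iff)
      \<comment> \<open>Otherwise, in either shape of \<open>C\<close>, the points of
        \<open>Y\<close> on one side and the right points in \<open>F\<close> would occupy more than
        the \<open>m - 1\<close> pairs different from \<open>i\<close>.\<close>
      have "\<exists>l. (l, True) \<in> Y \<and> (l, False) \<in> F"
      proof (rule ccontr)
        assume none: "\<not> ?thesis"
        from p show False
        proof
          assume nr: "nr C = 1"
          have nlC: "nl C = nl Y"
          proof -
            have "{l. (l, True) \<in> C} = {l. (l, True) \<in> Y}"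
              using CYr sl_Y[OF C(1)] by (auto simp: nl_eq_0[OF finCY])
            then show ?thesis by (simp add: nl_def)
          qed
          have "nl C = m - 2" using nr sl_counts[OF C(1)] by simp
          then have nlY: "nl Y = m - 2" using nlC by simp
          have "{l. (l, True) \<in> Y} \<subseteq> {..<m} - {i}" using iY Y_less by auto
          moreover have "{l. (l, True) \<in> Y} \<inter> {l. (l, False) \<in> F} = {}" using none by auto
          ultimately have "card {l. (l, True) \<in> Y} + card {l. (l, False) \<in> F} \<le> card ({..<m} - {i})"
            using idx_F by (subst card_Un_disjoint[symmetric]) (auto intro!: card_mono finite_fibre finF)
          then show False using nlY nrF card3 im m by (simp add: nl_def nr_def)
        next
          assume nl: "nl C = 0"
          then have "nl Y = 0" using sl_Y[OF C(1)] by (auto simp: nl_eq_0 finC)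
          then have "nr Y = card Y" using card_Y_left by simp
          moreover have "{l. (l, False) \<in> Y} \<subseteq> {..<m} - {i}" using iY Y_less by auto
          moreover have "{l. (l, False) \<in> Y} \<inter> {l. (l, False) \<in> F} = {}" by (auto simp: F_def free_iff)
          ultimately have "card {l. (l, False) \<in> Y} + card {l. (l, False) \<in> F} \<le> card ({..<m} - {i})"
            using idx_F by (subst card_Un_disjoint[symmetric]) (auto intro!: card_mono finite_fibre finF)
          then show False using \<open>nr Y = card Y\<close> nrF card3(2) im m by (simp add: nr_def)
        qed
      qed
      then obtain l where l: "(l, True) \<in> Y" "(l, False) \<in> F" by blast
      obtain k where k: "(k, False) \<in> F" "k \<noteq> l" using obtain_right[OF finF, of "{l}"] nrF card3 by auto
      have fr: "(l, False) \<in> free" "(k, False) \<in> free" "l \<noteq> i" "k \<noteq> i" using l k by (auto simp: F_def)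
      \<comment> \<open>\<open>(k, False)\<close> is forced into \<open>D\<close> to make
        \<open>nr D\<close> nonzero, as \<open>selP_two_rights\<close> demands.\<close>
      have "{(k, False)} \<subseteq> free" "{(i, True), (i, False), (l, False)} \<subseteq> free"
        "{(k, False)} \<inter> {(i, True), (i, False), (l, False)} = {}"
        "card Y + card {(k, False)} \<le> m - 1" "m - 1 + card W + card {(i, True), (i, False), (l, False)} \<le> 2 * m"
        using i fr k mid m by auto
      then obtain D where D: "sl (m - 1) D" "{(k, False)} \<subseteq> D" "D \<inter> {(i, True), (i, False), (l, False)} = {}"
        by (rule sl_choose)
      show False
        by (rule selP_two_rights[OF const m D(1) i(2) _ _ fr(1)])
          (use D l sl_Y[OF D(1)] nr_pos[OF sl_fin[OF D(1)], of k] in auto)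
    qed
  qed
qed

end

context slices
begin

lemma selP_not_constant:
  assumes const: "\<forall>A. sl m A \<longrightarrow> selP A = v" and m: "m \<ge> 5" and YW: "card Y + card W = m - 1"
  shows False
proof -
  have "m < card free" using card_free YW m by linarith
  then obtain i where i: "(i, True) \<in> free" "(i, False) \<in> free" by (rule ex_free_pair[OF free_sub])
  show False by (rule selP_no_free_pair[OF const m _ _ _ i]) (use YW in auto)
qed

text \<open>Here every pair has exactly one free point. Parity excludes points of \<open>Y\<close>
  and \<open>W\<close> on a common side, and \<open>selP_all_rights\<close> excludes
  \<open>Y\<close> on the right. The surviving arrangement is treated later with the help of
  \<open>selK\<close>.\<close>

lemma selP_constant_sides:
  assumes const: "\<forall>A. sl m A \<longrightarrow> selP A = v" and m: "m \<ge> 5"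
    and YW: "card Y + card W = m" "Y \<noteq> {}" "W \<noteq> {}"
  shows "Y \<subseteq> lefts m \<and> W \<subseteq> rights m"
proof -
  have pos: "card Y > 0" "card W > 0" using YW(2,3) by (auto simp: card_gt_0_iff)
  have card_free': "card free = m" using card_free YW(1) by simp
  have no_pair: "\<not> ((i, True) \<in> free \<and> (i, False) \<in> free)" for i
    using selP_no_free_pair[OF const m, of i] YW(1) pos by fastforce
  have partner: "(i, \<not> b) \<in> free" if "(i, b) \<in> Y \<union> W" for i b
    by (rule free_partner[OF no_pair card_free' that])
  have no_mix: False if ij: "(i, b) \<in> Y" "(j, b) \<in> W" for i j b
  proof -
    have fr: "(i, \<not> b) \<in> free" "(j, \<not> b) \<in> free" using partner ij by auto
    have "(i, \<not> b) \<noteq> (j, \<not> b)" using ij not_both by blast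
    moreover have "card Y \<le> m - 1" "m - 1 + card W + 2 \<le> 2 * m" using YW(1) pos by linarith+
    ultimately obtain C where C: "sl (m - 1) C" "(i, \<not> b) \<notin> C" "(j, \<not> b) \<notin> C"
      by (rule sl_avoid[OF fr])
    have mem: "(i, b) \<in> C" "(j, b) \<notin> C" using C ij sl_Y sl_W by auto
    have "selP (insert (i, \<not> b) C) = selP (insert (j, \<not> b) C)"
      by (rule selP_swap[OF const _ C(1) fr(1) C(2) fr(2) C(3)]) (use m in simp)
    moreover have "nl C \<noteq> 0" if b using mem that nl_pos sl_fin[OF C(1)] by auto
    ultimately show False
      using C mem sl_fin[OF C(1)] by (cases b) (auto simp: selP_def even_ns_insert)
  qed
  show ?thesis
  proof (rule one_sided[OF _ YW(2,3)])
    fix i j b assume "(i, b) \<in> Y" "(j, b) \<in> W"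
    then show False by (rule no_mix)
  next
    fix i j assume 1: "Y \<subseteq> rights m" "W \<subseteq> lefts m" "(i, False) \<in> Y" "(j, True) \<in> W"
    have fr: "(i, True) \<in> free" "(j, False) \<in> free"
      using partner[of i False] partner[of j True] 1 by auto
    have ne: "i \<noteq> j" and jm: "j < m" using 1 fr by (auto simp: free_iff)
    have "sl (m - 1) (rights m - {(j, False)})"
      using 1 fr by (auto simp: slice_def free_iff card_Diff_singleton_if)
    then show ?thesis using selP_all_rights[OF const m jm _ fr(2,1) ne] by blast
  qed auto
qed

section \<open>Slices on which \<open>selK\<close> is constant\<close>

lemma selK_pair:
  assumes const: "\<forall>A. sl (m - 1) A \<longrightarrow> selK A = v" and m: "m \<ge> 5"
    and C: "sl (m - 2) C" "(i, True) \<in> free" "(i, True) \<notin> C" "(i, False) \<in> free" "(i, False) \<notin> C"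
  shows "nr C = 1 \<and> even (ns C)"
proof -
  have "Suc (m - 2) = m - 1" using m by simp
  then have "selK (insert (i, True) C) = selK (insert (i, False) C)"
    using const sl_insert[OF C(1,2,3)] sl_insert[OF C(1,4,5)] by simp
  \<comment> \<open>For \<open>nr C = 0\<close> the values are \<open>False\<close> and
    \<open>True\<close>, and for \<open>nr C \<ge> 2\<close> the parities differ. For
    \<open>nr C = 1\<close> the first value is \<open>True\<close> and the second says that
    \<open>ns C\<close> is even.\<close>
  then show ?thesis
    using sl_fin[OF C(1)] C(3,5) by (auto simp: selK_def even_ns_insert split: if_splits)
qed

text \<open>The \<open>m + 1\<close> free points contain a pair, so \<open>selK_pair\<close>
  prescribes \<open>nr\<close> and the parity of \<open>ns\<close> for all sets of size
  \<open>m - 2\<close> in the slice that avoid this pair. Exchanging or adding further free points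
  breaks the prescription.\<close>

lemma selK_not_constant:
  assumes const: "\<forall>A. sl (m - 1) A \<longrightarrow> selK A = v" and m: "odd m" "m \<ge> 5"
    and YW: "card Y + card W = m - 1" "W \<noteq> {}"
  shows False
proof -
  have pos: "card W > 0" using YW(2) by (auto simp: card_gt_0_iff)
  have "m < card free" using card_free YW m by linarith
  then obtain i where i: "(i, True) \<in> free" "(i, False) \<in> free" by (rule ex_free_pair[OF free_sub])
  have iY: "(i, True) \<notin> Y" "(i, False) \<notin> Y" "(i, True) \<notin> W" and im: "i < m"
    using i by (auto simp: free_iff)
  note pair = selK_pair[OF const m(2) _ i(1) _ i(2)]
  define F where "F = free - {(i, True), (i, False)}"
  have F_free: "F \<subseteq> free" and finF: "finite F" by (auto simp: F_def)
  show False
  proof (cases "card W = 1")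
    case True
    then have sl: "sl (m - 2) Y" using Y_sub disj YW by (auto simp: slice_def)
    have p: "nr Y = 1" "even (ns Y)" using pair[OF sl iY(1,2)] by auto
    then have nl: "nl Y = m - 3" using sl_counts[OF sl] by simp
    obtain j where j: "(j, False) \<in> Y" using obtain_right[of Y "{}"] p by auto
    have uniq: "(k, False) \<notin> Y" if "k \<noteq> j" for k
      using nr_eq_1_iff[OF _ p(1) _ j, of k] that by auto
    \<comment> \<open>If pair \<open>j\<close> were complete, \<open>ns Y\<close> would be
      \<open>m - 4\<close>, which is odd.\<close>
    have jY: "(j, True) \<notin> Y"
    proof
      assume jT: "(j, True) \<in> Y"
      have "{k. (k, True) \<in> Y \<and> (k, False) \<notin> Y} = {k. (k, True) \<in> Y} - {j}"
        using j uniq by auto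
      then have "ns Y = nl Y - 1" using jT by (simp add: ns_def nl_def)
      then show False using nl p(2) m by auto
    qed
    have "card (fst ` W) \<le> 1" using card_image_le[of W fst] True by simp
    then have lt: "card (fst ` W) < nl Y" using nl m by linarith
    obtain l where l: "(l, True) \<in> Y" "l \<notin> fst ` W"
      by (rule obtain_left[OF _ lt]) auto
    have "l \<noteq> j" using l jY by auto
    then have lF: "(l, False) \<notin> Y" by (rule uniq)
    have "(l, False) \<notin> W" using l(2) by force
    then have fr: "(l, False) \<in> free" using lF Y_less[OF l(1)] by (simp add: free_iff)
    have "Suc (m - 2) = m - 1" using m by simp
    \<comment> \<open>The first set has one right point and value \<open>True\<close>; the second
      has two right points and odd \<open>ns\<close>.\<close>
    then have "selK (insert (i, True) Y) = selK (insert (l, False) Y)"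
      using const sl_insert[OF sl i(1) iY(1)] sl_insert[OF sl fr lF] by simp
    then show False using p l(1) lF iY by (simp add: selK_def even_ns_insert)
  next
    case False
    then have w2: "card W \<ge> 2" using pos by simp
    have "card F = card free - 2" using i by (simp add: F_def card_Diff_subset)
    then have cF: "card F = m - 1" using card_free YW m by linarith
    have "{} \<subseteq> free" "{(i, True), (i, False)} \<subseteq> free" "{} \<inter> {(i, True), (i, False)} = {}"
      "card Y + card {} \<le> m - 2" "m - 2 + card W + card {(i, True), (i, False)} \<le> 2 * m"
      using i YW w2 m by auto
    then obtain C where C: "sl (m - 2) C" "C \<inter> {(i, True), (i, False)} = {}" by (rule sl_choose)
    have p: "nr C = 1" "even (ns C)" using pair[OF C(1)] C(2) by auto
    have two: "sl (m - 2) (insert a D)" "nr (insert a D) = 1 \<and> even (ns (insert a D))"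
      if D: "sl (m - 3) D" "D \<inter> {(i, True), (i, False)} = {}" and a: "a \<in> F" "a \<notin> D" for a D
    proof -
      have "Suc (m - 3) = m - 2" using m by simp
      then show sl: "sl (m - 2) (insert a D)" using sl_insert[OF D(1) _ a(2)] a(1) by (simp add: F_def)
      show "nr (insert a D) = 1 \<and> even (ns (insert a D))"
        by (rule pair[OF sl]) (use D a in \<open>auto simp: F_def\<close>)
    qed
    have choose: thesis if ab: "a \<in> F" "b \<in> F" and
        "\<And>D. \<lbrakk>sl (m - 3) D; D \<inter> {(i, True), (i, False)} = {}; a \<notin> D; b \<notin> D\<rbrakk> \<Longrightarrow> thesis"
      for a b thesis
    proof -
      let ?Q = "{(i, True), (i, False), a, b}"
      have "card ?Q \<le> 4" by (simp add: card_insert_if)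
      then have "{} \<subseteq> free" "?Q \<subseteq> free" "{} \<inter> ?Q = {}"
        "card Y + card {} \<le> m - 3" "m - 3 + card W + card ?Q \<le> 2 * m"
        using i ab YW w2 m by (auto simp: F_def)
      then obtain D where "sl (m - 3) D" "D \<inter> ?Q = {}" by (rule sl_choose)
      then show thesis using that(3)[of D] by auto
    qed
    from F_free show False
    proof (rule sides)
      fix j k assume jk: "(j, True) \<in> F" "(k, False) \<in> F"
      obtain D where D: "sl (m - 3) D" "D \<inter> {(i, True), (i, False)} = {}" "(j, True) \<notin> D" "(k, False) \<notin> D"
        by (rule choose[OF jk])
      show False
        using two(2)[OF D(1,2) jk(1) D(3)] two(2)[OF D(1,2) jk(2) D(4)] D sl_fin[OF D(1)] by simp
    next
      assume left: "\<And>j. (j, False) \<notin> F"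
      have "nl F = card F" using card_nl_nr[OF finF] nr_eq_0[OF finF] left by simp
      moreover have "F \<subseteq> lefts m - {(i, True)}" using left free_sub by (auto simp: F_def free_iff) (metis (full_types))+
      ultimately have Feq: "F = lefts m - {(i, True)}"
        using cF im by (intro card_subset_eq) auto
      \<comment> \<open>\<open>F\<close> is the left side without pair \<open>i\<close>, so this
        right point comes from \<open>Y\<close>. Its partner completes a pair, whereas another left
        point creates a left-only pair.\<close>
      obtain j where j: "(j, False) \<in> C" using obtain_right[of C "{}"] p sl_fin[OF C(1)] by auto
      have ji: "j \<noteq> i" using j C(2) by auto
      have jm: "j < m" using sl_less[OF C(1) j] .
      have "(j, False) \<notin> free" using left[of j] ji by (auto simp: F_def)
      then have jY: "(j, False) \<in> Y" using j C(1) jm sl_W[OF C(1)] by (auto simp: free_iff)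
      have "card {i, j} < card {..<m}" using m by (simp add: card_insert_if)
      then have "\<not> {..<m} \<subseteq> {i, j}" by (metis card_mono finite.emptyI finite.insertI not_le)
      then obtain k where k: "k < m" "k \<noteq> i" "k \<noteq> j" by auto
      have jk: "(j, True) \<in> F" "(k, True) \<in> F" using Feq ji jm k by auto
      obtain D where D: "sl (m - 3) D" "D \<inter> {(i, True), (i, False)} = {}" "(j, True) \<notin> D" "(k, True) \<notin> D"
        by (rule choose[OF jk])
      have jD: "(j, False) \<in> D" by (rule sl_Y[OF D(1) jY])
      have "nr D = 1" using two(2)[OF D(1,2) jk(1) D(3)] D sl_fin[OF D(1)] by simp
      then have "(k, False) \<notin> D" using nr_eq_1_iff[OF sl_fin[OF D(1)] _ _ jD] k by auto
      then show False
        using two(2)[OF D(1,2) jk(1) D(3)] two(2)[OF D(1,2) jk(2) D(4)] D jD sl_fin[OF D(1)]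
        by (simp add: even_ns_insert)
    next
      assume right: "\<And>j. (j, True) \<notin> F"
      have "nr F = card F" using card_nl_nr[OF finF] nl_eq_0[OF finF] right by simp
      moreover have "F \<subseteq> rights m - {(i, False)}" using right free_sub by (auto simp: F_def free_iff) (metis (full_types))+
      ultimately have Feq: "F = rights m - {(i, False)}"
        using cF im by (intro card_subset_eq) auto
      \<comment> \<open>\<open>F\<close> is the right side without pair \<open>i\<close>, so
        \<open>Y\<close> turns out to consist of \<open>m - 3\<close> left points; adding a right
        point opposite one of them makes \<open>ns\<close> odd.\<close>
      have rY: "(j, False) \<notin> Y" for j
      proof
        assume "(j, False) \<in> Y"
        then have "(j, False) \<in> F" using iY Y_less by (auto simp: Feq)
        then show False using \<open>(j, False) \<in> Y\<close> by (auto simp: F_def free_iff)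
      qed
      then have nrY: "nr Y = 0" by (simp add: nr_eq_0)
      have nlY: "nl Y = card Y" using nrY card_Y_left by simp
      have lC: "(j, True) \<in> C \<longleftrightarrow> (j, True) \<in> Y" for j
        using C right[of j] sl_Y[OF C(1)] by (auto simp: slice_def F_def free_def)
      then have "nl C = nl Y" by (simp add: nl_def)
      then have cY: "card Y = m - 3" using nlY p sl_counts[OF C(1)] by simp
      then have evY: "even (ns Y)" using ns_no_right[OF _ nrY] nlY m by simp
      obtain j where j: "(j, True) \<in> Y" using obtain_left[of Y "{}"] nlY cY m by auto
      have jF: "(j, False) \<in> F" using Feq j iY Y_less by auto
      have "sl (m - 3) Y" using Y_sub disj cY by (auto simp: slice_def)
      from two(2)[OF this _ jF rY] show False
        using evY iY j rY by (simp add: even_ns_insert)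
    qed
  qed
qed

end

section \<open>Deleting single points\<close>

lemma counts_remove_left:
  assumes "finite R" "(k, True) \<in> R"
  shows "nl (R - {(k, True)}) = nl R - 1" "nr (R - {(k, True)}) = nr R"
    "even (ns (R - {(k, True)})) \<longleftrightarrow> (even (ns R) \<longleftrightarrow> (k, False) \<in> R)"
proof -
  define S where "S = R - {(k, True)}"
  have "R = insert (k, True) S" "(k, True) \<notin> S" "finite S" "(k, False) \<in> S \<longleftrightarrow> (k, False) \<in> R"
    using assms by (auto simp: S_def)
  then show "nl (R - {(k, True)}) = nl R - 1" "nr (R - {(k, True)}) = nr R"
    "even (ns (R - {(k, True)})) \<longleftrightarrow> (even (ns R) \<longleftrightarrow> (k, False) \<in> R)"
    unfolding S_def[symmetric] using even_ns_insert_left[of S k] by auto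
qed

lemma counts_remove_right:
  assumes "finite R" "(k, False) \<in> R"
  shows "nr (R - {(k, False)}) = nr R - 1" "nl (R - {(k, False)}) = nl R"
    "even (ns (R - {(k, False)})) \<longleftrightarrow> (even (ns R) \<longleftrightarrow> (k, True) \<notin> R)"
proof -
  define S where "S = R - {(k, False)}"
  have "R = insert (k, False) S" "(k, False) \<notin> S" "finite S" "(k, True) \<in> S \<longleftrightarrow> (k, True) \<in> R"
    using assms by (auto simp: S_def)
  then show "nr (R - {(k, False)}) = nr R - 1" "nl (R - {(k, False)}) = nl R"
    "even (ns (R - {(k, False)})) \<longleftrightarrow> (even (ns R) \<longleftrightarrow> (k, True) \<notin> R)"
    unfolding S_def[symmetric] using even_ns_insert_right[of S k] by auto
qed

text \<open>Serves the case where no point is forced and \<open>R\<close> is the set of free points,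
  so that the sets \<open>R - {r}\<close> form the slice of size \<open>m - 1\<close>. Each value of
  \<open>nr R\<close> either determines \<open>v\<close> or admits two deletions with different
  values of \<open>selK\<close>.\<close>

lemma selK_constant_below:
  assumes R: "R \<subseteq> board m" "card R = m" and m: "odd m" "m \<ge> 5"
    and const: "\<And>r. r \<in> R \<Longrightarrow> selK (R - {r}) = v"
  shows "selP R \<noteq> v \<and> selQ R \<noteq> v"
proof -
  have fin: "finite R" using finite_subset[OF R(1) finite_board] .
  have sum: "nl R + nr R = m" using card_nl_nr[OF fin] R(2) by simp
  note left = counts_remove_left[OF fin] and right = counts_remove_right[OF fin]
  consider "nr R = 0" | "nr R = 1" | "nr R = 2" | "nr R \<ge> 3" "nl R = 0" | "nr R \<ge> 3" "nl R \<noteq> 0" by linarith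
  then show ?thesis
  proof cases
    case 1
    then obtain k where k: "(k, True) \<in> R" using obtain_left[OF fin, of "{}"] sum m by auto
    have "v = False" using const[OF k] left[OF k] 1 by (simp add: selK_def)
    moreover have "ns R = m" using ns_no_right[OF fin 1] sum 1 by simp
    ultimately show ?thesis using 1 sum m by (simp add: selP_def selQ_def)
  next
    case 2
    then obtain k where k: "(k, True) \<in> R" using obtain_left[OF fin, of "{}"] sum m by auto
    obtain j where j: "(j, False) \<in> R" using obtain_right[OF fin, of "{}"] 2 by auto
    show ?thesis using const[OF k] left[OF k] const[OF j] right[OF j] 2 by (simp add: selK_def)
  next
    case 3
    obtain j where j: "(j, False) \<in> R" using obtain_right[OF fin, of "{}"] 3 by auto
    have v: "v" using const[OF j] right[OF j] 3 by (simp add: selK_def)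
    have "card {k. (k, False) \<in> R} < nl R" using 3 sum m by (simp add: nr_def)
    then obtain k where k: "(k, True) \<in> R" "k \<notin> {k. (k, False) \<in> R}"
      by (rule obtain_left[OF fin]) (use finite_fibre[OF fin] in auto)
    then have "odd (ns R)" using const[OF k(1)] left[OF k(1)] v 3 by (simp add: selK_def)
    then show ?thesis using v 3 sum m by (simp add: selP_def selQ_def)
  next
    case 4
    obtain j where j: "(j, False) \<in> R" using obtain_right[OF fin, of "{}"] 4 by auto
    have ns: "ns R = 0" by (rule ns_no_left[OF fin 4(2)])
    have "(j, True) \<notin> R" using nl_pos[OF fin] 4(2) by blast
    moreover have "\<not> nr R - 1 \<le> 1" using 4 by simp
    ultimately have v using const[OF j] right[OF j] ns by (simp add: selK_def)
    then show ?thesis using 4 ns by (simp add: selP_def selQ_def)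
  next
    case 5
    have l: "v \<longleftrightarrow> (even (ns R) \<longleftrightarrow> (k, False) \<in> R)" if "(k, True) \<in> R" for k
      using const[OF that] left[OF that] 5 by (simp add: selK_def)
    have "\<not> nr R - 1 \<le> 1" using 5 by simp
    then have r: "v \<longleftrightarrow> (even (ns R) \<longleftrightarrow> (k, True) \<notin> R)" if "(k, False) \<in> R" for k
      using const[OF that] right[OF that] by (simp add: selK_def)
    obtain k where k: "(k, True) \<in> R" using obtain_left[OF fin, of "{}"] 5 by auto
    obtain j where j: "(j, False) \<in> R" using obtain_right[OF fin, of "{}"] 5 by auto
    \<comment> \<open>In a complete pair, deleting the right point changes the parity of
      \<open>ns\<close> and deleting the left one does not; without complete pairs it is the other
      way round.\<close>
    have False
      using l[OF k] r[of k] r[OF j] l[of j] j k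
      by (cases "even (ns R)"; cases "(k, False) \<in> R"; cases "(j, True) \<in> R") simp_all
    then show ?thesis ..
  qed
qed

section \<open>Joint constancy of \<open>selP\<close>, \<open>selQ\<close> and
  \<open>selN\<close>\<close>

context slices
begin

text \<open>If one side holds a single point, the other holds \<open>m - 1 \<ge> 4\<close>, and
  exactly one of \<open>selP\<close> and \<open>selQ\<close> is flipped.\<close>

lemma selPQ_agree:
  assumes "\<forall>A. sl m A \<longrightarrow> selP A = v" "\<forall>A. sl m A \<longrightarrow> selQ A = v" "m \<ge> 5" "sl m B"
  shows "nr B \<noteq> 1 \<and> nl B \<noteq> 1"
proof -
  have "selP B = selQ B" using assms by simp
  moreover have "nl B + nr B = m" by (rule sl_counts[OF assms(4)])
  ultimately show ?thesis using assms(3) unfolding selP_def selQ_def by presburger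
qed

text \<open>\<open>Y\<close> itself is the slice member of size \<open>m\<close>, and those of size
  \<open>m + 1\<close> arise from it by adding one free point, so \<open>selP Y\<close> is compared
  with \<open>selN\<close> on these.\<close>

lemma selPQN_not_constant_one:
  assumes constP: "\<forall>A. sl m A \<longrightarrow> selP A = v" and constQ: "\<forall>A. sl m A \<longrightarrow> selQ A = v"
    and constN: "\<forall>A. sl (Suc m) A \<longrightarrow> selN A = v"
    and m: "odd m" "m \<ge> 5" and YW: "card Y = m" "card W = 1"
  shows False
proof -
  obtain w where w: "\<And>x. x \<in> W \<longleftrightarrow> x = w" using YW(2) by (auto simp: card_1_singleton_iff)
  have sl: "sl m Y" using Y_sub disj YW(1) by (auto simp: slice_def)
  have sum: "nl Y + nr Y = m" by (rule sl_counts[OF sl])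
  have P: "selP Y = v" using constP sl by blast
  have N: "selN (insert a Y) = v" if "a \<in> free" for a
    using constN sl_insert[OF sl that] that by (auto simp: free_def)
  have not1: "nr Y \<noteq> 1" "nl Y \<noteq> 1" using selPQ_agree[OF constP constQ m(2) sl] by auto
  have card_free': "card free = m - 1" using card_free YW by simp
  have "free \<noteq> {}" using card_free' m by auto
  consider "nr Y = 0" | "nl Y = 0" | "nr Y \<ge> 2" "nl Y \<ge> 2" using not1 by linarith
  then show False
  proof cases
    case 1
    then have "Y \<subseteq> lefts m" using nr_eq_0_iff[OF Y_sub] by simp
    then have Yeq: "Y = lefts m" using YW(1) by (intro card_subset_eq) auto
    obtain x where x: "x \<in> free" using \<open>free \<noteq> {}\<close> by blast
    obtain k b where kb: "x = (k, b)" by fastforce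
    have kb': "(k, b) \<notin> Y" "k < m" using x kb by (auto simp: free_iff)
    then have "(k, b) \<notin> lefts m" "k < m" using Yeq by simp_all
    then have k: "x = (k, False)" "k < m" using kb by auto
    show False using N[OF x] P k m by (simp add: Yeq selP_def selN_def even_ns_insert)
  next
    case 2
    then have "Y \<subseteq> rights m" using nl_eq_0_iff[OF Y_sub] by simp
    then have Yeq: "Y = rights m" using YW(1) by (intro card_subset_eq) auto
    obtain x where x: "x \<in> free" using \<open>free \<noteq> {}\<close> by blast
    obtain k b where kb: "x = (k, b)" by fastforce
    have kb': "(k, b) \<notin> Y" "k < m" using x kb by (auto simp: free_iff)
    then have "(k, b) \<notin> rights m" "k < m" using Yeq by simp_all
    then have k: "x = (k, True)" "k < m" using kb by auto
    show False using N[OF x] P k m by (simp add: Yeq selP_def selN_def)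
  next
    case 3
    have v: "v \<longleftrightarrow> even (ns Y)" using P 3 by (simp add: selP_def)
    define A where "A = {k. (k, False) \<in> Y}"
    have finA: "finite A" and card_A: "card A = nr Y" by (auto simp: A_def nr_def finite_fibre)
    \<comment> \<open>Otherwise the free left point of pair \<open>k\<close> could be added without
      changing \<open>ns\<close>, and \<open>selN\<close> would differ from
      \<open>selP Y\<close>.\<close>
    have A_cover: "(k, True) \<in> Y \<or> w = (k, True)" if k: "k \<in> A" for k
    proof (rule ccontr)
      assume "\<not> ?thesis"
      then have fr: "(k, True) \<in> free" using k w Y_less by (auto simp: A_def free_iff)
      have "\<not> nl Y + 1 \<le> 2" using 3 by simp
      then show False
        using N[OF fr] fr k v unfolding A_def free_iff by (simp add: selN_def even_ns_insert)
    qed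
    have "fst ` free \<subseteq> {..<m} - A"
    proof
      fix k assume "k \<in> fst ` free"
      then obtain b where b: "(k, b) \<in> free" by force
      then show "k \<in> {..<m} - A" using A_cover[of k] w by (cases b) (auto simp: A_def free_iff)
    qed
    moreover have "A \<subseteq> {..<m}" using Y_less by (auto simp: A_def)
    ultimately have "card (fst ` free) \<le> m - nr Y"
      using card_mono[of "{..<m} - A" "fst ` free"] finA card_A by (simp add: card_Diff_subset)
    \<comment> \<open>The \<open>m - 1\<close> free points lie in the at most \<open>m - 2\<close>
      pairs outside \<open>A\<close>, so some pair is entirely free.\<close>
    then have "card (fst ` free) < card free" using card_free' 3 m by linarith
    then have "\<not> inj_on fst free" by (rule pigeonhole)
    then obtain x y where "x \<in> free" "y \<in> free" "fst x = fst y" "x \<noteq> y" by (auto simp: inj_on_def)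
    then obtain i where i: "(i, True) \<in> free" "(i, False) \<in> free"
      by (cases x; cases y; cases "snd x"; cases "snd y") auto
    have iY: "(i, True) \<notin> Y" "(i, False) \<notin> Y" using i by (auto simp: free_iff)
    show False
    proof (cases "nl Y = 2")
      case False
      then have "\<not> nl Y \<le> 2" using 3 by simp
      then show False using N[OF i(2)] iY v by (simp add: selN_def even_ns_insert)
    next
      case True
      then have "\<not> v" using N[OF i(2)] iY by (simp add: selN_def)
      then have "odd (ns Y)" using v by simp
      have "A \<subseteq> {k. (k, True) \<in> Y} \<union> {fst w}"
      proof
        fix k assume "k \<in> A"
        then show "k \<in> {k. (k, True) \<in> Y} \<union> {fst w}" using A_cover[of k] by auto
      qed
      moreover have c3: "card ({k. (k, True) \<in> Y} \<union> {fst w}) \<le> 3"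
        using True card_insert_le_m1[of 3 "{k. (k, True) \<in> Y}" "fst w"] by (simp add: nl_def)
      moreover have "card A \<ge> 3" using card_A sum True m by simp
      \<comment> \<open>At least three right points are covered by two left points and
        \<open>w\<close>. Equality puts a right point opposite every left point of
        \<open>Y\<close>.\<close>
      ultimately have A: "A = {k. (k, True) \<in> Y} \<union> {fst w}"
        by (intro card_seteq) (auto intro: finite_fibre)
      have "k \<in> A" if "(k, True) \<in> Y" for k unfolding A using that by simp
      then have "{k. (k, True) \<in> Y \<and> (k, False) \<notin> Y} = {}" by (auto simp: A_def)
      then have "ns Y = 0" unfolding ns_def by (simp only: card.empty)
      then show False using \<open>odd (ns Y)\<close> by simp
    qed
  qed
qed

text \<open>
  A free point as in \<open>ex_neutral\<close> can be inserted without changing the parity of \<open>ns\<close>, unless its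
  partner is free as well.
\<close>

lemma selPQN_not_constant_mid:
  assumes constP: "\<forall>A. sl m A \<longrightarrow> selP A = v" and constQ: "\<forall>A. sl m A \<longrightarrow> selQ A = v"
    and constN: "\<forall>A. sl (Suc m) A \<longrightarrow> selN A = v"
    and m: "odd m" "m \<ge> 5" and YW: "card Y + card W = Suc m" "card Y \<ge> 2" "card W \<ge> 2"
    and ex_neutral: "\<exists>j b. (j, b) \<in> free \<and> \<not> (if b then (j, False) \<in> W else (j, True) \<in> Y)"
  shows False
proof -
  have card_free': "card free = m - 1" using card_free YW by simp
  have agree: "nr B \<noteq> 1 \<and> nl B \<noteq> 1" if "sl m B" for B
    by (rule selPQ_agree[OF constP constQ m(2) that])
  have ins: "sl m (insert a C)" if "sl (m - 1) C" "a \<in> free" "a \<notin> C" for a C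
    using sl_insert[OF that] m by simp
  \<comment> \<open>By \<open>agree\<close> no side has exactly one point, so nonzero counts are at
    least two and \<open>selP\<close> is the plain parity.\<close>
  have Peq: "even (ns (insert a C)) = even (ns (insert b C))"
    if C: "sl (m - 1) C" "a \<in> free" "a \<notin> C" "b \<in> free" "b \<notin> C"
      and c: "nr (insert a C) \<noteq> 0" "nl (insert a C) \<noteq> 0" "nr (insert b C) \<noteq> 0" "nl (insert b C) \<noteq> 0" for a b C
  proof -
    have "nr (insert a C) \<ge> 2" "nr (insert b C) \<ge> 2"
      using agree[OF ins[OF C(1,2,3)]] agree[OF ins[OF C(1,4,5)]] c by linarith+
    then show ?thesis
      by (intro selP_unflipped[OF constP m(2) C(1-5)]) (use c in auto)
  qed
  have le: "card Y \<le> m - 1" "m - 1 + card W + 2 \<le> 2 * m" using YW m by linarith+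
  have no_pair: "\<not> ((i, True) \<in> free \<and> (i, False) \<in> free)" for i
  proof
    assume i: "(i, True) \<in> free \<and> (i, False) \<in> free"
    obtain C where C: "sl (m - 1) C" "(i, True) \<notin> C" "(i, False) \<notin> C"
      by (rule sl_avoid[of "(i, True)" "(i, False)" "m - 1"]) (use i le in auto)
    have "nr (insert (i, True) C) \<noteq> 1 \<and> nl (insert (i, True) C) \<noteq> 1"
      "nr (insert (i, False) C) \<noteq> 1 \<and> nl (insert (i, False) C) \<noteq> 1"
      using agree[OF ins[OF C(1) _ C(2)]] agree[OF ins[OF C(1) _ C(3)]] i by auto
    then have c: "nr C \<noteq> 0" "nl C \<noteq> 0" using C sl_fin[OF C(1)] by auto
    then have "even (ns (insert (i, True) C)) = even (ns (insert (i, False) C))"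
      using Peq[OF C(1) _ C(2) _ C(3)] i C sl_fin[OF C(1)] by simp
    then show False using C sl_fin[OF C(1)] by (simp add: even_ns_insert)
  qed
  \<comment> \<open>\<open>act j b\<close> means that inserting the free point \<open>(j, b)\<close>
    changes the parity of \<open>ns\<close>; as its partner is not free, this does not depend on the
    slice member.\<close>
  define act where "act j b \<longleftrightarrow> (if b then (j, False) \<in> W else (j, True) \<in> Y)" for j b
  have neutral: "(if b then (j, False) \<in> Y else (j, True) \<in> W)" if "(j, b) \<in> free" "\<not> act j b" for j b
    using that no_pair[of j] by (cases b) (auto simp: act_def free_iff)
  have parity: "even (ns (insert (j, b) C)) \<longleftrightarrow> (even (ns C) \<longleftrightarrow> \<not> act j b)"
    if "(j, b) \<in> free" "(j, b) \<notin> C" "sl k C" for j b C k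
  proof (cases b)
    case True
    have "(j, False) \<in> C \<longleftrightarrow> \<not> act j b"
      using neutral[OF that(1)] sl_Y[OF that(3)] sl_W[OF that(3)] True by (auto simp: act_def)
    then show ?thesis using that(2) sl_fin[OF that(3)] True by (simp add: even_ns_insert)
  next
    case False
    have "(j, True) \<in> C \<longleftrightarrow> act j b"
      using neutral[OF that(1)] sl_Y[OF that(3)] sl_W[OF that(3)] False by (auto simp: act_def)
    then show ?thesis using that(2) sl_fin[OF that(3)] False by (simp add: even_ns_insert)
  qed
  \<comment> \<open>An active and a neutral point inserted into the same \<open>C\<close> give
    different parities, and a neutral one exists by \<open>ex_neutral\<close>.\<close>
  have all_neutral: "\<not> act j b" if jb: "(j, b) \<in> free" for j b
  proof
    assume act: "act j b"
    obtain k c where kc: "(k, c) \<in> free" "\<not> act k c" using ex_neutral by (auto simp: act_def)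
    then have "(j, b) \<noteq> (k, c)" using act by (metis prod.inject)
    then obtain C where C: "sl (m - 1) C" "(j, b) \<notin> C" "(k, c) \<notin> C"
      by (rule sl_avoid[OF jb kc(1) _ le])
    note f = sl_fin[OF C(1)]
    have nr: "nr C \<noteq> 0"
    proof (cases c)
      case True
      then have "(k, False) \<in> C" using neutral[OF kc] sl_Y[OF C(1)] by simp
      then show ?thesis using nr_pos[OF f] by blast
    next
      case False
      then show ?thesis using agree[OF ins[OF C(1) kc(1) C(3)]] C(3) f by auto
    qed
    have nl: "nl C \<noteq> 0"
    proof (cases b)
      case True
      then show ?thesis using agree[OF ins[OF C(1) jb C(2)]] C(2) f by auto
    next
      case False
      then have "(j, True) \<in> C" using act sl_Y[OF C(1)] by (simp add: act_def)
      then show ?thesis using nl_pos[OF f] by blast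
    qed
    have nz: "nr (insert (i, d) C) \<noteq> 0 \<and> nl (insert (i, d) C) \<noteq> 0" if "(i, d) \<notin> C" for i d
      using that nr nl f by (cases d) auto
    have "even (ns (insert (j, b) C)) = even (ns (insert (k, c) C))"
      by (rule Peq[OF C(1) jb C(2) kc(1) C(3)]) (use nz[OF C(2)] nz[OF C(3)] in auto)
    then show False using parity[OF jb C(2,1)] parity[OF kc(1) C(3,1)] act kc(2) by simp
  qed
  from order_refl[of free] show False
  proof (rule sides)
    fix j k assume jk: "(j, True) \<in> free" "(k, False) \<in> free"
    obtain C where C: "sl (m - 1) C" "(j, True) \<notin> C" "(k, False) \<notin> C"
      by (rule sl_avoid[OF jk _ le]) auto
    note f = sl_fin[OF C(1)]
    \<comment> \<open>On \<open>B\<close>, with two points on each side, \<open>selP\<close> is the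
      plain parity. A neutral left point raises \<open>nl\<close> above \<open>2\<close>, where
      \<open>selN\<close> is the opposite parity.\<close>
    define B where "B = insert (k, False) C"
    have B: "sl m B" unfolding B_def by (rule ins[OF C(1) jk(2) C(3)])
    have jB: "(j, True) \<notin> B" using C(2) by (simp add: B_def)
    have "nl C \<noteq> 0" using agree[OF ins[OF C(1) jk(1) C(2)]] C(2) f by auto
    then have c: "nl B \<ge> 2" "nr B \<ge> 2" using agree[OF B] C(3) f by (auto simp: B_def)
    then have "v \<longleftrightarrow> even (ns B)" using constP B by (auto simp: selP_def)
    moreover have "sl (Suc m) (insert (j, True) B)" by (rule sl_insert[OF B jk(1) jB])
    then have "selN (insert (j, True) B) = v" using constN by blast
    ultimately show False
      using c parity[OF jk(1) jB B] all_neutral[OF jk(1)] jB sl_fin[OF B] by (simp add: selN_def)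
  next
    assume none: "\<And>j. (j, False) \<notin> free"
    \<comment> \<open>Every free point is a left point opposite a point of \<open>Y\<close>, so
      \<open>Y\<close> consists of \<open>m - 1\<close> right points; an added left point is alone
      on its side, against \<open>agree\<close>.\<close>
    have "{j. (j, True) \<in> free} \<subseteq> {j. (j, False) \<in> Y}"
      using neutral[OF _ all_neutral, of _ True] by auto
    then have "nl free \<le> nr Y" unfolding nl_def nr_def by (intro card_mono finite_fibre) auto
    moreover have "nl free = m - 1"
      using card_nl_nr[of free] nr_eq_0[of free] none card_free' by simp
    ultimately have Y: "card Y = m - 1" "nl Y = 0" using card_Y_left le by linarith+
    have slY: "sl (m - 1) Y" using Y_sub disj Y by (auto simp: slice_def)
    have "free \<noteq> {}" using card_free' m by auto
    then obtain j where j: "(j, True) \<in> free" using none by (metis (full_types) ex_in_conv surj_pair)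
    then have jY: "(j, True) \<notin> Y" by (simp add: free_iff)
    show False using agree[OF ins[OF slY j jY]] jY Y by simp
  next
    assume none: "\<And>j. (j, True) \<notin> free"
    \<comment> \<open>Every free point is a right point opposite a point of \<open>W\<close>. Slice
      members then have at most one left point, hence none by \<open>agree\<close>, and at most one
      right point remains for \<open>Y\<close>.\<close>
    have "{j. (j, False) \<in> free} \<subseteq> {j. (j, True) \<in> W}"
      using neutral[OF _ all_neutral, of _ False] by auto
    then have nlW: "nr free \<le> nl W" unfolding nl_def nr_def by (intro card_mono finite_fibre) auto
    have nrF: "nr free = m - 1"
      using card_nl_nr[of free] nl_eq_0[of free] none card_free' by simp
    have "{} \<subseteq> free" "{} \<subseteq> free" "{} \<inter> {} = {}" "card Y + card {} \<le> m" "m + card W + card {} \<le> 2 * m"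
      using YW by auto
    then obtain B where B: "sl m B" by (rule sl_choose)
    note f = sl_fin[OF B]
    have "card ({j. (j, True) \<in> B} \<union> {j. (j, True) \<in> W}) \<le> card {..<m}"
      using sl_less[OF B] W_less by (intro card_mono) auto
    moreover have "card ({j. (j, True) \<in> B} \<union> {j. (j, True) \<in> W}) = nl B + nl W"
      unfolding nl_def using sl_W[OF B] by (intro card_Un_disjoint finite_fibre f) auto
    ultimately have "nl B \<le> 1" using nlW nrF m by simp
    then have "nl B = 0" using agree[OF B] by linarith
    then have nlY: "nl Y = 0" using nl_eq_0[OF f] nl_eq_0[of Y] sl_Y[OF B] by auto
    have "card ({j. (j, False) \<in> Y} \<union> {j. (j, False) \<in> free}) \<le> card {..<m}"
      using Y_less by (intro card_mono) (auto simp: free_iff)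
    moreover have "card ({j. (j, False) \<in> Y} \<union> {j. (j, False) \<in> free}) = nr Y + nr free"
      unfolding nr_def by (intro card_Un_disjoint finite_fibre) (auto simp: free_iff)
    ultimately have "nr Y \<le> 1" using nrF m by simp
    then show False using YW card_Y_left nlY by simp
  qed
qed

end

subsection \<open>The selector for even dimension\<close>

definition even_sel :: "nat \<Rightarrow> (nat \<times> bool) set \<Rightarrow> bool" where
  "even_sel m A \<longleftrightarrow>
     (let B = A \<inter> board m in
      if (m, True) \<in> A then (if (m, False) \<in> A then selK B else selP B)
      else (if (m, False) \<in> A then selQ B else selN B))"

section \<open>Splitting off the last pair\<close>

lemma board_Suc: "board (Suc m) = insert (m, True) (insert (m, False) (board m))"
  by (auto simp: board_def less_Suc_eq)

lemma card_board_Suc: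
  assumes "X \<subseteq> board (Suc m)"
  shows "card X = card (X \<inter> board m) + (if (m, True) \<in> X then 1 else 0) + (if (m, False) \<in> X then 1 else 0)"
proof -
  have "X = (X \<inter> board m) \<union> (X \<inter> {(m, True), (m, False)})" using assms by (auto simp: board_Suc)
  moreover have "card ((X \<inter> board m) \<union> (X \<inter> {(m, True), (m, False)}))
      = card (X \<inter> board m) + card (X \<inter> {(m, True), (m, False)})"
    by (intro card_Un_disjoint) auto
  moreover have "card (X \<inter> {(m, True), (m, False)})
      = (if (m, True) \<in> X then 1 else 0) + (if (m, False) \<in> X then 1 else 0)"
    by (simp add: Int_insert_right)
  ultimately show ?thesis by (metis add.assoc)
qed

lemma compl_counts:
  assumes "B \<subseteq> board m"
  shows "nl (board m - B) = m - nl B" "nr (board m - B) = m - nr B" "nl B \<le> m" "nr B \<le> m"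
    "even (ns (board m - B)) \<longleftrightarrow> (even (ns B) \<longleftrightarrow> even (card B))"
proof -
  have "finite B" using finite_subset[OF assms finite_board] .
  then have "card B = nl B + nr B" by (rule card_nl_nr)
  moreover have "even (ns (board m - B) + nl B) = even (ns B + nr B)" using ns_compl[OF assms] by simp
  ultimately show "even (ns (board m - B)) \<longleftrightarrow> (even (ns B) \<longleftrightarrow> even (card B))" by auto
qed (use assms nl_compl nr_compl nl_le nr_le in auto)

lemma selP_compl:
  assumes "B \<subseteq> board m" "card B = m" "odd m"
  shows "selP (board m - B) \<longleftrightarrow> \<not> selQ B" and "selQ (board m - B) \<longleftrightarrow> \<not> selP B"
proof -
  have "nl B + nr B = m" using card_nl_nr[OF finite_subset[OF assms(1) finite_board]] assms(2) by simp
  then have "nl (board m - B) = nr B" "nr (board m - B) = nl B" using compl_counts[OF assms(1)] by auto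
  then show "selP (board m - B) \<longleftrightarrow> \<not> selQ B" "selQ (board m - B) \<longleftrightarrow> \<not> selP B"
    using compl_counts(5)[OF assms(1)] assms(2,3) by (auto simp: selP_def selQ_def)
qed

text \<open>The complement has \<open>nr B + 1\<close> left points, which makes the exceptional
  ranges correspond; as \<open>card B\<close> is even, the parity of \<open>ns\<close> is kept and
  only its sense differs.\<close>

lemma selN_compl:
  assumes "B \<subseteq> board m" "Suc (card B) = m" "odd m"
  shows "selN (board m - B) \<longleftrightarrow> \<not> selK B"
proof -
  have "Suc (nl B + nr B) = m" using card_nl_nr[OF finite_subset[OF assms(1) finite_board]] assms(2) by simp
  then have "nl (board m - B) = Suc (nr B)" using compl_counts[OF assms(1)] by auto
  moreover have "even (ns (board m - B)) \<longleftrightarrow> even (ns B)"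
    using compl_counts(5)[OF assms(1)] assms(2,3) by auto
  ultimately show ?thesis by (auto simp: selN_def selK_def)
qed

lemma even_sel_compl:
  assumes A: "A \<subseteq> board (Suc m)" "card A = Suc m" and m: "odd m"
  shows "even_sel m (board (Suc m) - A) \<longleftrightarrow> \<not> even_sel m A"
proof -
  define B where "B = A \<inter> board m"
  have B: "B \<subseteq> board m" "board m - (board m - B) = B" by (auto simp: B_def)
  have finB: "finite B" by (rule finite_subset[OF B(1) finite_board])
  have cut: "(board (Suc m) - A) \<inter> board m = board m - B" by (auto simp: B_def board_Suc)
  note card_B = card_board_Suc[OF A(1), folded B_def, unfolded A(2)]
  have B': "card (board m - B) + card B = 2 * m"
    using card_Diff_subset[OF finB B(1)] card_mono[OF finite_board B(1)] by simp
  have mem: "(m, b) \<in> board (Suc m) - A \<longleftrightarrow> (m, b) \<notin> A" for b by simp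
  show ?thesis
    unfolding even_sel_def Let_def cut mem B_def[symmetric]
    using selP_compl[OF B(1) _ m] selN_compl[OF B(1) _ m] selN_compl[of "board m - B" m] card_B B' B(2) m
    by auto
qed

text \<open>Extending by a fixed trace \<open>T\<close> on the last pair is the way in which
  constancy of \<open>even_sel\<close> descends to one of its four parts.\<close>

lemma slice_lift:
  assumes "slice (board m) (Y \<inter> board m) (W \<inter> board m) k B"
    and "Y \<subseteq> board (Suc m)" "W \<subseteq> board (Suc m)"
    and "T \<subseteq> {(m, True), (m, False)}" "T \<inter> W = {}" "Y - board m \<subseteq> T" "k + card T = n"
  shows "slice (board (Suc m)) Y W n (B \<union> T)" and "(B \<union> T) \<inter> board m = B"
    and "(m, b) \<in> B \<union> T \<longleftrightarrow> (m, b) \<in> T"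
proof -
  have T: "T \<inter> board m = {}" "finite T" using assms(4) finite_subset by auto
  have B: "B \<subseteq> board m" "finite B" "card B = k"
    using assms(1) finite_subset[OF _ finite_board] by (auto simp: slice_def)
  have "card (B \<union> T) = n"
    using assms(7) T B by (subst card_Un_disjoint) auto
  then show "slice (board (Suc m)) Y W n (B \<union> T)"
    using assms B by (auto simp: slice_def board_Suc)
  show "(B \<union> T) \<inter> board m = B" using B T by auto
  show "(m, b) \<in> B \<union> T \<longleftrightarrow> (m, b) \<in> T" using B(1) by auto
qed

text \<open>\<open>position\<close> lists the positions of the last pair relative to
  \<open>Y\<close> and \<open>W\<close> up to exchanging \<open>Y\<close> and \<open>W\<close>. Each
  trace on this pair that \<open>Y\<close> and \<open>W\<close> admit makes one part constant on a
  slice of \<open>board m\<close>.\<close>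

lemma even_sel_not_constant_core:
  fixes m :: nat and Y W :: "(nat \<times> bool) set"
  defines "p \<equiv> (m, True)" and "q \<equiv> (m, False)"
  assumes m: "odd m" "m \<ge> 5"
    and YW: "Y \<subseteq> board (Suc m)" "W \<subseteq> board (Suc m)" "Y \<inter> W = {}" "Y \<noteq> {}" "W \<noteq> {}"
      "card Y + card W = Suc m"
    and const: "\<forall>A. slice (board (Suc m)) Y W (Suc m) A \<longrightarrow> even_sel m A = v"
    and position: "p \<in> Y \<and> q \<in> Y \<or> p \<in> Y \<and> q \<in> W \<or> p \<in> Y \<and> q \<notin> Y \<union> W \<or> q \<in> Y \<and> p \<notin> Y \<union> W \<or>
      p \<notin> Y \<union> W \<and> q \<notin> Y \<union> W \<and> (card W = 1 \<or> 2 \<le> card Y \<and> 2 \<le> card W \<and>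
        (\<exists>j b. (j, b) \<in> board m - Y - W \<and> \<not> (if b then (j, False) \<in> W else (j, True) \<in> Y)))"
  shows False
proof -
  define Y' where "Y' = Y \<inter> board m"
  define W' where "W' = W \<inter> board m"
  interpret s: slices m Y' W' using YW(3) by unfold_locales (auto simp: Y'_def W'_def)
  have pq: "p \<notin> board m" "q \<notin> board m" "p \<noteq> q" by (auto simp: p_def q_def)
  note card_Y = card_board_Suc[OF YW(1), folded Y'_def p_def q_def]
    and card_W = card_board_Suc[OF YW(2), folded W'_def p_def q_def]
  have outside: "Y - board m \<subseteq> {p, q}" "W - board m \<subseteq> {p, q}"
    using YW(1,2) by (auto simp: board_Suc p_def q_def)
  have disj: "x \<in> Y \<Longrightarrow> x \<notin> W" for x using YW(3) by auto
  have lift: "even_sel m (B \<union> T) = v" "(B \<union> T) \<inter> board m = B" "(m, b) \<in> B \<union> T \<longleftrightarrow> (m, b) \<in> T"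
    if "s.sl k B" "T \<subseteq> {p, q}" "T \<inter> W = {}" "Y - board m \<subseteq> T" "k + card T = Suc m" for B T k b
    using slice_lift[OF that(1)[unfolded Y'_def W'_def] YW(1,2), of T "Suc m"] that const
    by (auto simp: p_def q_def)
  have K: "\<forall>B. s.sl (m - 1) B \<longrightarrow> selK B = v" if "p \<notin> W" "q \<notin> W"
  proof (intro allI impI)
    fix B assume B: "s.sl (m - 1) B"
    have "{p, q} \<subseteq> {p, q}" "{p, q} \<inter> W = {}" "Y - board m \<subseteq> {p, q}" "m - 1 + card {p, q} = Suc m"
      using that outside pq(3) m by auto
    note l = lift[OF B this]
    show "selK B = v"
      using l(1) unfolding even_sel_def Let_def l(2) l(3) by (simp add: p_def q_def)
  qed
  have P: "\<forall>B. s.sl m B \<longrightarrow> selP B = v" if "p \<notin> W" "q \<notin> Y"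
  proof (intro allI impI)
    fix B assume B: "s.sl m B"
    have "{p} \<subseteq> {p, q}" "{p} \<inter> W = {}" "Y - board m \<subseteq> {p}" "m + card {p} = Suc m"
      using that outside by auto
    note l = lift[OF B this]
    show "selP B = v"
      using l(1) unfolding even_sel_def Let_def l(2) l(3) by (simp add: p_def q_def)
  qed
  have Q: "\<forall>B. s.sl m B \<longrightarrow> selQ B = v" if "q \<notin> W" "p \<notin> Y"
  proof (intro allI impI)
    fix B assume B: "s.sl m B"
    have "{q} \<subseteq> {p, q}" "{q} \<inter> W = {}" "Y - board m \<subseteq> {q}" "m + card {q} = Suc m"
      using that outside by auto
    note l = lift[OF B this]
    show "selQ B = v"
      using l(1) unfolding even_sel_def Let_def l(2) l(3) by (simp add: p_def q_def)
  qed
  have N: "\<forall>B. s.sl (Suc m) B \<longrightarrow> selN B = v" if "p \<notin> Y" "q \<notin> Y"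
  proof (intro allI impI)
    fix B assume B: "s.sl (Suc m) B"
    have "{} \<subseteq> {p, q}" "{} \<inter> W = {}" "Y - board m \<subseteq> {}" "Suc m + card ({} :: (nat \<times> bool) set) = Suc m"
      using that outside by auto
    note l = lift[OF B this]
    show "selN B = v"
      using l(1) unfolding even_sel_def Let_def l(2) l(3) by (simp add: p_def q_def)
  qed
  \<comment> \<open>With no point forced, the free points form the only member of size
    \<open>m\<close>, and \<open>selK_constant_below\<close> applies to it.\<close>
  have empty: False if sum: "card Y' + card W' = m" "Y' = {}" and K': "\<forall>B. s.sl (m - 1) B \<longrightarrow> selK B = v"
    and PQ: "(\<forall>B. s.sl m B \<longrightarrow> selP B = v) \<or> (\<forall>B. s.sl m B \<longrightarrow> selQ B = v)"
  proof -
    have cR: "card s.free = m" using s.card_free sum by simp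
    have "Y' \<subseteq> s.free" using sum(2) by blast
    moreover have "s.free \<inter> W' = {}" by (auto simp: s.free_def)
    ultimately have slR: "s.sl m s.free" using cR s.free_sub unfolding slice_def by blast
    have "selK (s.free - {r}) = v" if "r \<in> s.free" for r
    proof -
      have "s.free - {r} \<subseteq> board m" using s.free_sub by blast
      moreover have "card (s.free - {r}) = m - 1" using cR that by simp
      moreover have "Y' \<subseteq> s.free - {r}" using sum(2) by blast
      moreover have "(s.free - {r}) \<inter> W' = {}" using \<open>s.free \<inter> W' = {}\<close> by blast
      ultimately have "s.sl (m - 1) (s.free - {r})" unfolding slice_def by blast
      then show ?thesis using K' by blast
    qed
    from selK_constant_below[OF s.free_sub cR m this] PQ slR show False by blast
  qed
  have lr: "selP (lefts m)" "\<not> selQ (rights m)" using m by (auto simp: selP_def selQ_def)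
  consider "p \<in> Y" "q \<in> Y" | "p \<in> Y" "q \<in> W" | "p \<in> Y" "q \<notin> Y \<union> W" | "q \<in> Y" "p \<notin> Y \<union> W"
    | "p \<notin> Y \<union> W" "q \<notin> Y \<union> W"
    using position by blast
  then show False
  proof cases
    case 1
    then have "W' \<noteq> {}" using YW(5) outside(2) disj by (auto simp: W'_def)
    moreover have "card Y' + card W' = m - 1" using card_Y card_W YW(6) 1 disj by simp
    ultimately show False
      using s.selK_not_constant[OF K m] 1 disj by blast
  next
    case 2
    have "card Y' + card W' = m - 1" using card_Y card_W YW(6) 2 disj disj[of q] by auto
    then show False using s.selP_not_constant[OF P m(2)] 2 disj by blast
  next
    case 3
    then have W': "W' \<noteq> {}" using YW(5) outside(2) disj by (auto simp: W'_def)
    have sum: "card Y' + card W' = m" using card_Y card_W YW(6) 3 disj by auto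
    have P': "\<forall>B. s.sl m B \<longrightarrow> selP B = v" and K': "\<forall>B. s.sl (m - 1) B \<longrightarrow> selK B = v"
      using P K 3 disj by auto
    show False
    proof (cases "Y' = {}")
      case True
      then show False using empty[OF sum True K'] P' by blast
    next
      case False
      then have sides: "Y' \<subseteq> lefts m" "W' \<subseteq> rights m"
        using s.selP_constant_sides[OF P' m(2) sum False W'] by auto
      \<comment> \<open>Through \<open>selP\<close>, \<open>lefts m\<close> gives \<open>v\<close>;
        with a left point outside \<open>Y'\<close> deleted it still has no right point, so
        \<open>selK\<close> is false on it.\<close>
      have "s.sl m (lefts m)" using sides by (auto simp: slice_def)
      then have v using P' lr by blast
      have "card W' > 0" using W' s.fin(2) by (simp add: card_gt_0_iff)
      then have "card Y' < card (lefts m)" using sum card_lefts_rights[of m] by linarith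
      then have "\<not> lefts m \<subseteq> Y'" by (metis card_mono s.fin(1) not_le)
      then have "\<not> (\<forall>k<m. (k, True) \<in> Y')" by (auto simp: lefts_def)
      then obtain k where k: "k < m" "(k, True) \<notin> Y'" by blast
      have "s.sl (m - 1) (lefts m - {(k, True)})" using sides k by (auto simp: slice_def)
      then have "selK (lefts m - {(k, True)}) = v" using K' by blast
      then show False using \<open>v\<close> counts_lefts_rights_remove[OF k(1)] by (simp add: selK_def)
    qed
  next
    case 4
    then have W': "W' \<noteq> {}" using YW(5) outside(2) disj by (auto simp: W'_def)
    have sum: "card Y' + card W' = m" using card_Y card_W YW(6) 4 disj by auto
    have Q': "\<forall>B. s.sl m B \<longrightarrow> selQ B = v" and K': "\<forall>B. s.sl (m - 1) B \<longrightarrow> selK B = v"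
      using Q K 4 disj by auto
    show False
    proof (cases "Y' = {}")
      case True
      then show False using empty[OF sum True K'] Q' by blast
    next
      case False
      \<comment> \<open>Complementation turns \<open>selQ\<close> into \<open>selP\<close> and
        exchanges forced and forbidden points.\<close>
      interpret t: slices m W' Y' using s.Y_sub s.W_sub s.disj by unfold_locales auto
      have "\<forall>B. t.sl m B \<longrightarrow> selP B = (\<not> v)"
      proof (intro allI impI)
        fix B assume B: "t.sl m B"
        then have "s.sl m (board m - B)" using slice_compl[OF B finite_board s.Y_sub] by simp
        then have "selQ (board m - B) = v" using Q' by blast
        then show "selP B = (\<not> v)" using selP_compl(2)[OF t.sl_sub[OF B] t.sl_card[OF B] m(1)] by auto
      qed
      moreover have "card W' + card Y' = m" using sum by simp
      ultimately have sides: "W' \<subseteq> lefts m" "Y' \<subseteq> rights m"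
        using t.selP_constant_sides[OF _ m(2) _ W' False] by auto
      have "s.sl m (rights m)" using sides by (auto simp: slice_def)
      then have "\<not> v" using Q' lr by blast
      have "card W' > 0" using W' s.fin(2) by (simp add: card_gt_0_iff)
      then have "card Y' < card (rights m)" using sum card_lefts_rights[of m] by linarith
      then have "\<not> rights m \<subseteq> Y'" by (metis card_mono s.fin(1) not_le)
      then have "\<not> (\<forall>k<m. (k, False) \<in> Y')" by (auto simp: rights_def)
      then obtain k where k: "k < m" "(k, False) \<notin> Y'" by blast
      have "s.sl (m - 1) (rights m - {(k, False)})" using sides k by (auto simp: slice_def)
      then have "selK (rights m - {(k, False)}) = v" using K' by blast
      moreover have "\<not> m - Suc 0 \<le> Suc 0" using m(2) by linarith
      ultimately show False using \<open>\<not> v\<close> counts_lefts_rights_remove[OF k(1)] by (simp add: selK_def)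
    qed
  next
    case 5
    have sum: "card Y' = card Y" "card W' = card W" using card_Y card_W 5 by auto
    have P': "\<forall>B. s.sl m B \<longrightarrow> selP B = v" and Q': "\<forall>B. s.sl m B \<longrightarrow> selQ B = v"
      and N': "\<forall>B. s.sl (Suc m) B \<longrightarrow> selN B = v"
      using P Q N 5 by auto
    show False
    proof (cases "card W = 1")
      case True
      then show False using s.selPQN_not_constant_one[OF P' Q' N' m] sum YW(6) by simp
    next
      case False
      then have pos: "2 \<le> card Y" "2 \<le> card W"
        and ex: "\<exists>j b. (j, b) \<in> board m - Y - W \<and> \<not> (if b then (j, False) \<in> W else (j, True) \<in> Y)"
        using position 5 by auto
      then obtain j b where jb: "(j, b) \<in> board m - Y - W" "\<not> (if b then (j, False) \<in> W else (j, True) \<in> Y)"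
        by blast
      then have "(j, b) \<in> s.free" "\<not> (if b then (j, False) \<in> W' else (j, True) \<in> Y')"
        unfolding s.free_def by (auto simp: Y'_def W'_def split: if_splits)
      then show False
        using s.selPQN_not_constant_mid[OF P' Q' N' m] sum YW(6) pos by metis
    qed
  qed
qed

lemma even_sel_not_constant:
  assumes m: "odd m" "m \<ge> 5"
    and YW: "Y \<subseteq> board (Suc m)" "W \<subseteq> board (Suc m)" "Y \<inter> W = {}" "Y \<noteq> {}" "W \<noteq> {}"
      "card Y + card W = Suc m"
    and const: "\<forall>A. slice (board (Suc m)) Y W (Suc m) A \<longrightarrow> even_sel m A = v"
  shows False
proof -
  have WY: "W \<inter> Y = {}" "card W + card Y = Suc m" using YW by auto
  \<comment> \<open>Exchanging \<open>Y\<close> and \<open>W\<close> negates the constant value, so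
    the core lemma can be used in both orientations.\<close>
  have dual: "\<forall>A. slice (board (Suc m)) W Y (Suc m) A \<longrightarrow> even_sel m A = (\<not> v)"
  proof (intro allI impI)
    fix A assume A: "slice (board (Suc m)) W Y (Suc m) A"
    then have "slice (board (Suc m)) Y W (Suc m) (board (Suc m) - A)"
      using slice_compl[OF A finite_board YW(1)] by simp
    moreover have "A \<subseteq> board (Suc m)" "card A = Suc m" using A by (auto simp: slice_def)
    ultimately show "even_sel m A = (\<not> v)" using const even_sel_compl[of A m] m(1) by blast
  qed
  note core = even_sel_not_constant_core[OF m YW const]
    and core' = even_sel_not_constant_core[OF m YW(2,1) WY(1) YW(5,4) WY(2) dual]
  show False
  proof (cases "(m, True) \<in> Y \<union> W \<or> (m, False) \<in> Y \<union> W")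
    case True
    then show False using core core' by blast
  next
    case False
    have fin: "finite Y" "finite W" using YW(1,2) finite_subset[OF _ finite_board] by auto
    then have pos: "card Y > 0" "card W > 0" using YW(4,5) by (auto simp: card_gt_0_iff)
    consider "card W = 1" | "card Y = 1" | "2 \<le> card Y" "2 \<le> card W" using pos by linarith
    then show False
    proof cases
      case 1
      then show False using core False by blast
    next
      case 2
      then show False using core' False by blast
    next
      case 3
      interpret s: slices m Y W
        using YW(1-3) False by unfold_locales (auto simp: board_Suc)
      have "card s.free = m - 1" using s.card_free YW(6) by simp
      then have "s.free \<noteq> {}" using m by auto
      then obtain x where x: "x \<in> s.free" by blast
      obtain j b where jb: "(j, b) \<in> board m - Y - W" using x unfolding s.free_def by (cases x) blast
      show False
      \<comment> \<open>Since \<open>Y\<close> and \<open>W\<close> are disjoint, a free point that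
        is not neutral for \<open>(Y, W)\<close> is neutral for \<open>(W, Y)\<close>.\<close>
      proof (cases "if b then (j, False) \<in> W else (j, True) \<in> Y")
        case True
        then have "\<not> (if b then (j, False) \<in> Y else (j, True) \<in> W)" using s.not_both by (auto split: if_splits)
        moreover have "(j, b) \<in> board m - W - Y" using jb by auto
        ultimately show False using core' False 3 by blast
      next
        case F: False
        then show False using core False 3 jb by blast
      qed
    qed
  qed
qed

section \<open>Bounds from the two selectors\<close>

lemma sat_VC_odd:
  assumes d: "odd d" "d \<ge> 3" and n: "n \<ge> 2 * d"
  shows "2 * sat_VC n (d - 1) \<le> (2 * d) choose d"
proof (rule sat_VC_le_half_choose[where G = "board d" and f = odd_sel])
  show "odd_sel (board d - A) \<longleftrightarrow> \<not> odd_sel A" if "A \<subseteq> board d" "card A = d" for A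
    using odd_sel_compl[OF d(1) that] .
  fix Y W :: "(nat \<times> bool) set"
  assume YW: "Y \<subseteq> board d" "W \<subseteq> board d" "Y \<inter> W = {}" "Y \<noteq> {}" "W \<noteq> {}" "card Y + card W = d"
  interpret s: slices d Y W using YW(1-3) by unfold_locales
  interpret t: slices d W Y using YW(1-3) by unfold_locales auto
  show "\<exists>A\<subseteq>board d. card A = d \<and> Y \<subseteq> A \<and> A \<inter> W = {} \<and> odd_sel A"
  proof (rule ccontr)
    assume "\<not> ?thesis"
    then have F: "\<not> odd_sel A" if "s.sl d A" for A using that unfolding slice_def by blast
    have T: "odd_sel A = True" if A: "t.sl d A" for A
    proof -
      have "s.sl d (board d - A)" using slice_compl[OF A finite_board YW(1)] by simp
      then show ?thesis using F odd_sel_compl[OF d(1) t.sl_sub[OF A] t.sl_card[OF A]] by simp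
    qed
    have pos: "card Y > 0" "card W > 0" using YW(4,5) by (auto simp: card_gt_0_iff)
    show False
    proof (cases "card W < d - 1")
      case True
      show False
        by (rule s.odd_sel_not_constant[OF d YW(4-6) True, of False]) (use F in simp)
    next
      case False
      \<comment> \<open>Here \<open>card Y = 1\<close>, and the complementary slice has the size
        that \<open>odd_sel_not_constant\<close> requires.\<close>
      then have "card W + card Y = d" "card Y < d - 1" using pos YW(6) d(2) by linarith+
      then show False using t.odd_sel_not_constant[OF d YW(5,4), of True] T by blast
    qed
  qed
qed (use d n in auto)

lemma sat_VC_even:
  assumes d: "even d" "d \<ge> 6" and n: "n \<ge> 2 * d"
  shows "2 * sat_VC n (d - 1) \<le> (2 * d) choose d"
proof -
  obtain m where dm: "d = Suc m" using d(2) by (cases d) auto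
  then have m: "odd m" "m \<ge> 5" using d by auto
  show ?thesis
  proof (rule sat_VC_le_half_choose[where G = "board d" and f = "even_sel m"])
    show "even_sel m (board d - A) \<longleftrightarrow> \<not> even_sel m A" if "A \<subseteq> board d" "card A = d" for A
      using even_sel_compl[of A m] that m(1) dm by simp
    fix Y W :: "(nat \<times> bool) set"
    assume YW: "Y \<subseteq> board d" "W \<subseteq> board d" "Y \<inter> W = {}" "Y \<noteq> {}" "W \<noteq> {}" "card Y + card W = d"
    show "\<exists>A\<subseteq>board d. card A = d \<and> Y \<subseteq> A \<and> A \<inter> W = {} \<and> even_sel m A"
    proof (rule ccontr)
      assume "\<not> ?thesis"
      then have "\<forall>A. slice (board d) Y W d A \<longrightarrow> even_sel m A = False" unfolding slice_def by blast
      then show False using even_sel_not_constant[OF m] YW unfolding dm by blast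
    qed
  qed (use d n in auto)
qed

subsection \<open>Dimension four\<close>

text \<open>Subsets of \<open>{..<n}\<close> are encoded as Boolean lists of length
  \<open>n\<close>, and traces by \<open>select\<close>, so that the finite checks can be
  evaluated.\<close>

primrec all_bools :: "nat \<Rightarrow> bool list list" where
  "all_bools 0 = [[]]"
| "all_bools (Suc n) = map ((#) False) (all_bools n) @ map ((#) True) (all_bools n)"

primrec bits :: "nat \<Rightarrow> nat \<Rightarrow> bool list" where
  "bits 0 k = []"
| "bits (Suc n) k = odd k # bits n (k div 2)"

fun select :: "bool list \<Rightarrow> bool list \<Rightarrow> bool list" where
  "select (x # X) (a # A) = (if x then a # select X A else select X A)"
| "select _ _ = []"

primrec set_of :: "bool list \<Rightarrow> nat set" where
  "set_of [] = {}"
| "set_of (a # A) = (if a then {0} else {}) \<union> Suc ` set_of A"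

lemma set_all_bools: "set (all_bools n) = {A. length A = n}"
  by (induction n) (auto simp: length_Suc_conv image_iff)

lemma length_bits [simp]: "length (bits n k) = n"
  by (induction n arbitrary: k) auto

lemma set_of_subset: "set_of A \<subseteq> {..<length A}"
  by (induction A) auto

lemma obtain_bools:
  assumes "A \<subseteq> {..<n}"
  obtains B where "length B = n" "set_of B = A"
proof -
  have "\<exists>B. length B = n \<and> set_of B = A"
    using assms
  proof (induction n arbitrary: A)
    case (Suc n)
    have "{i. Suc i \<in> A} \<subseteq> {..<n}" using Suc.prems by auto
    then obtain B where B: "length B = n" "set_of B = {i. Suc i \<in> A}" using Suc.IH by blast
    have "set_of ((0 \<in> A) # B) = A"
    proof (rule set_eqI)
      fix i show "i \<in> set_of ((0 \<in> A) # B) \<longleftrightarrow> i \<in> A" using B(2) by (cases i) auto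
    qed
    then show ?case using B(1) by (intro exI[of _ "(0 \<in> A) # B"]) simp
  qed auto
  then show thesis using that by blast
qed

lemma finite_set_of [simp]: "finite (set_of A)"
  by (induction A) auto

lemma card_set_of: "card (set_of X) = count_list X True"
proof (induction X)
  case (Cons x X)
  have "card (Suc ` set_of X) = count_list X True" using Cons by (simp add: card_image)
  then show ?case by simp
qed simp

lemma Suc_image_eq_iff: "Suc ` A = Suc ` B \<longleftrightarrow> A = B"
  by (simp add: inj_image_eq_iff)

lemma insert_zero_Suc_image_eq_iff: "insert 0 (Suc ` A) = insert 0 (Suc ` B) \<longleftrightarrow> A = B"
proof
  assume "insert 0 (Suc ` A) = insert 0 (Suc ` B)"
  then have "insert 0 (Suc ` A) - {0} = insert 0 (Suc ` B) - {0}" by simp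
  then have "Suc ` A = Suc ` B" by auto
  then show "A = B" by (simp add: Suc_image_eq_iff)
qed simp

lemma set_of_Cons_Int:
  "set_of (a # A) \<inter> set_of (x # X) = (if a \<and> x then {0} else {}) \<union> Suc ` (set_of A \<inter> set_of X)"
  by auto

lemma set_of_eq_imp:
  assumes "length A = length B" "set_of A = set_of B"
  shows "A = B"
  using assms
proof (induction A B rule: list_induct2)
  case (Cons a A b B)
  have "insert 0 (Suc ` C) \<noteq> Suc ` D" "Suc ` D \<noteq> insert 0 (Suc ` C)" for C D by auto
  then have "a = b \<and> set_of A = set_of B"
    using Cons.prems
    by (cases a; cases b) (simp_all add: Suc_image_eq_iff insert_zero_Suc_image_eq_iff)
  then show ?case using Cons.IH by simp
qed simp

lemma select_eq_iff:
  assumes "length A = length X" "length B = length X"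
  shows "select X A = select X B \<longleftrightarrow> set_of A \<inter> set_of X = set_of B \<inter> set_of X"
  using assms
proof (induction X arbitrary: A B)
  case (Cons x X)
  obtain a A' b B' where A: "A = a # A'" "B = b # B'"
    using Cons.prems by (metis length_Suc_conv length_Cons)
  have "select X A' = select X B' \<longleftrightarrow> set_of A' \<inter> set_of X = set_of B' \<inter> set_of X"
    using Cons A by simp
  moreover have "insert 0 (Suc ` C) \<noteq> Suc ` D" "Suc ` D \<noteq> insert 0 (Suc ` C)" for C D by auto
  ultimately show ?case
    unfolding A set_of_Cons_Int
    by (cases x; cases a; cases b) (simp_all add: Suc_image_eq_iff insert_zero_Suc_image_eq_iff)
qed simp

lemma length_select: "length A = length X \<Longrightarrow> length (select X A) = count_list X True"
  by (induction X A rule: select.induct) auto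

lemma ex_select:
  assumes "length p = count_list X True"
  shows "\<exists>A. length A = length X \<and> select X A = p"
  using assms
proof (induction X arbitrary: p)
  case (Cons x X)
  show ?case
  proof (cases x)
    case True
    then obtain a q where p: "p = a # q" "length q = count_list X True"
      using Cons.prems by (cases p) auto
    then obtain A where "length A = length X" "select X A = q" using Cons.IH by blast
    then show ?thesis using True p by (intro exI[of _ "a # A"]) simp
  next
    case False
    then obtain A where "length A = length X" "select X A = p" using Cons.IH[of p] Cons.prems by auto
    then show ?thesis using False by (intro exI[of _ "False # A"]) simp
  qed
qed simp

text \<open>
  The family was found by computer search; bit \<open>0\<close> of a number is the point to be duplicated.
  \<open>List.member\<close> stands in for membership in \<open>set\<close>, which is too slow to evaluate by rewriting.
\<close>

definition fam4 :: "bool list list" where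
  "fam4 = map (bits 7) [5, 9, 10, 13, 15, 20, 25, 34, 36, 38, 40, 42, 44, 46, 51, 54, 56, 66, 83,
    85, 87, 90, 93, 94, 97, 98, 101, 103, 105, 106, 108, 110, 115, 119, 122]"

definition sets4 :: "bool list list" where
  "sets4 = filter (\<lambda>X. count_list X True = 4) (all_bools 7)"

definition missing :: "bool list \<Rightarrow> bool list list" where
  "missing X = (let T = map (select X) fam4 in filter (\<lambda>p. \<not> List.member T p) (all_bools 4))"

lemma fam4_not_shattering: "\<forall>X\<in>set sets4. missing X \<noteq> []"
  by code_simp

text \<open>Each set outside the family has to supply the only missing trace on some set of size
  four. The list \<open>L\<close> holds the missing traces together with their sets.\<close>

lemma fam4_saturating:
  "let L = map (\<lambda>X. (X, missing X)) sets4
   in \<forall>A\<in>set (all_bools 7). List.member fam4 A \<or> (\<exists>(X, P)\<in>set L. P = [select X A])"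
  by code_simp

text \<open>The head of a list stands for point \<open>0\<close>; this gives the condition
  \<open>sep\<close> of \<open>pull_saturated\<close> for that point.\<close>

lemma fam4_sep:
  "\<forall>A\<in>set (all_bools 6). \<not> (List.member fam4 (False # A) \<and> List.member fam4 (True # A))"
  by code_simp

lemma sat_VC_four:
  assumes n: "n \<ge> 8"
  shows "sat_VC n 3 \<le> 35"
proof -
  define \<F> where "\<F> = set_of ` set fam4"
  have len: "length A = 7" if "A \<in> set fam4" for A using that by (auto simp: fam4_def)
  have sets4: "X \<in> set sets4 \<longleftrightarrow> length X = 7 \<and> card (set_of X) = 4" for X
    by (auto simp: sets4_def set_all_bools card_set_of)
  have missing: "p \<in> set (missing X) \<longleftrightarrow> length p = 4 \<and> (\<forall>B\<in>set fam4. select X B \<noteq> p)" for p X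
    by (auto simp: missing_def Let_def set_all_bools)
  have sub: "\<F> \<subseteq> Pow {..<7}" using set_of_subset len unfolding \<F>_def by fastforce
  have not_shattered: "card Z \<noteq> 4" if Z: "shatters \<F> Z" for Z
  proof
    assume "card Z = 4"
    obtain X where X: "length X = 7" "set_of X = Z"
      using obtain_bools shatters_subset[OF Z sub] by metis
    then have "X \<in> set sets4" using sets4 \<open>card Z = 4\<close> by simp
    then obtain p where p: "p \<in> set (missing X)" using fam4_not_shattering by (meson last_in_set)
    then have "length p = count_list X True" using missing X \<open>card Z = 4\<close> card_set_of[of X] by simp
    then obtain A where A: "length A = 7" "select X A = p" using ex_select X(1) by metis
    obtain F where F: "F \<in> \<F>" "F \<inter> Z = set_of A \<inter> Z" by (rule shattersD[OF Z, of "set_of A \<inter> Z"]) auto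
    then obtain B where B: "B \<in> set fam4" "F = set_of B" by (auto simp: \<F>_def)
    have "select X B = select X A" using select_eq_iff[of B X A] F(2) B len A(1) X by simp
    then show False using A(2) p missing B(1) by blast
  qed
  have sat: "\<exists>Z\<subseteq>{..<7}. card Z = 4 \<and> shatters (insert F \<F>) Z" if F: "F \<subseteq> {..<7}" "F \<notin> \<F>" for F
  proof -
    obtain A where A: "length A = 7" "set_of A = F" using obtain_bools[OF F(1)] by blast
    then have "A \<notin> set fam4" using F(2) by (auto simp: \<F>_def)
    moreover have "A \<in> set (all_bools 7)" using A(1) by (simp add: set_all_bools)
    ultimately have "\<exists>X\<in>set sets4. missing X = [select X A]"
      using fam4_saturating unfolding Let_def by fastforce
    then obtain X where "X \<in> set sets4" and missing_X: "missing X = [select X A]" by blast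
    then have X: "length X = 7" "card (set_of X) = 4" using sets4 by auto
    have "shatters (insert F \<F>) (set_of X)"
      unfolding shatters_iff
    proof (intro allI impI)
      fix Y assume Y: "Y \<subseteq> set_of X"
      then have "Y \<subseteq> {..<7}" using set_of_subset[of X] X(1) by auto
      then obtain B where B: "length B = 7" "set_of B = Y" by (rule obtain_bools)
      have YX: "set_of B \<inter> set_of X = Y" using Y B(2) by blast
      have "length (select X B) = 4" using length_select[of B X] B X card_set_of[of X] by simp
      then consider "select X B = select X A" | C where "C \<in> set fam4" "select X C = select X B"
        using missing[of "select X B" X] missing_X by auto
      then show "\<exists>H\<in>insert F \<F>. H \<inter> set_of X = Y"
      proof cases
        case 1
        then have "F \<inter> set_of X = Y" using select_eq_iff[of B X A] A B X(1) YX by simp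
        then show ?thesis by blast
      next
        case 2
        then have "set_of C \<inter> set_of X = Y" using select_eq_iff[of C X B] len B X(1) YX by simp
        then show ?thesis using 2(1) by (auto simp: \<F>_def)
      qed
    qed
    moreover have "set_of X \<subseteq> {..<7}" using set_of_subset[of X] X(1) by simp
    ultimately show ?thesis using X(2) by blast
  qed
  have sep: "insert 0 F \<notin> \<F>" if F: "F \<in> \<F>" "0 \<notin> F" for F
  proof
    assume "insert 0 F \<in> \<F>"
    then obtain B where B: "B \<in> set fam4" "set_of B = insert 0 F" by (auto simp: \<F>_def)
    obtain A where A: "A \<in> set fam4" "set_of A = F" using F(1) by (auto simp: \<F>_def)
    obtain a A' b B' where AB: "A = a # A'" "B = b # B'" "length A' = 6" "length B' = 6"
      using len[OF A(1)] len[OF B(1)] by (cases A; cases B) auto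
    have a: "\<not> a" using A(2) F(2) AB(1) by (auto split: if_splits)
    have "set_of B = set_of (True # A')" using B(2) A(2) AB(1) a by simp
    then have "B = True # A'" using set_of_eq_imp[of B "True # A'"] len[OF B(1)] AB(3) by simp
    then show False using fam4_sep A(1) B(1) AB(1,3) a by (auto simp: set_all_bools)
  qed
  obtain \<phi> where \<phi>: "\<phi> ` {1..n} = {..<7}"
    and fib: "\<And>i j. \<lbrakk>i \<in> {1..n}; j \<in> {1..n}; i \<noteq> j; \<phi> i = \<phi> j\<rbrakk> \<Longrightarrow> \<phi> i = (0 :: nat)"
  proof (rule obtain_pull_map[of "{..<7::nat}" 0 n])
  qed (use n in auto)
  have sep': "insert (\<phi> i) F \<notin> \<F>"
    if "i \<in> {1..n}" "j \<in> {1..n}" "i \<noteq> j" "\<phi> i = \<phi> j" "F \<in> \<F>" "\<phi> i \<notin> F" for i j F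
    using sep[of F] fib[OF that(1-4)] that(5,6) by simp
  have "(1::nat) \<le> 4" "4 \<le> card {..<7::nat}" by simp_all
  note pull = pull_saturated[OF \<phi> sub this not_shattered sat sep']
  have "sat_VC n 3 \<le> card (pull \<phi> n ` \<F>)" using sat_VC_le[OF pull(1)] by simp
  also have "\<dots> = card \<F>" by (rule pull(2))
  also have "\<dots> \<le> length fam4" unfolding \<F>_def using card_image_le[of "set fam4" set_of] card_length[of fam4] by simp
  also have "\<dots> = 35" by (simp add: fam4_def)
  finally show ?thesis .
qed

lemma sat_VC_le_half_central_binomial:
  assumes "d \<ge> 3" "n \<ge> 2 * d"
  shows "2 * sat_VC n (d - 1) \<le> (2 * d) choose d"
proof -
  consider "odd d" | "even d" "d \<ge> 6" | "d = 4"
  proof -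
    have "d = 3 \<or> d = 4 \<or> d = 5 \<or> d \<ge> 6" using assms(1) by linarith
    then show thesis using that by auto
  qed
  then show ?thesis
  proof cases
    case 1
    then show ?thesis using sat_VC_odd assms by blast
  next
    case 2
    then show ?thesis using sat_VC_even assms by blast
  next
    case 3
    have "(8::nat) choose 4 = 70" by code_simp
    then show ?thesis using sat_VC_four[of n] 3 assms(2) by simp
  qed
qed

theorem theorem2:
  fixes d n :: nat
  assumes "d \<ge> 3" and "n \<ge> 2 * d"
  shows "sat_VC n (d - 1) \<le> 4 ^ d \<and>
         (odd d \<or> d \<ge> 14 \<longrightarrow> real (sat_VC n (d - 1)) \<le> 1 / 2 * real ((2 * d) choose d))"
proof -
  have le: "2 * sat_VC n (d - 1) \<le> (2 * d) choose d"
    by (rule sat_VC_le_half_central_binomial[OF assms])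
  also have "\<dots> \<le> 2 ^ (2 * d)" by (rule binomial_le_pow2)
  also have "\<dots> = 4 ^ d" by (simp add: power_mult)
  finally have "sat_VC n (d - 1) \<le> 4 ^ d" by simp
  moreover have "real (sat_VC n (d - 1)) \<le> 1 / 2 * real ((2 * d) choose d)"
    using of_nat_mono[OF le, where 'a = real] by simp
  ultimately show ?thesis by blast
qed

end
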